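(* Let $n=p_1p_2\cdots p_\ell$ ($\ell\ge1$) be a product of distinct odd primes. Then $$\Psi^w_{\mathbb{Z}_n}(x)=\frac{1}{\phi(n)}\sum_{(d_1,\dots,d_\ell)}\left(\prod_{i=1}^{\ell}\phi\!\left(\frac{p_i-1}{d_i}\right)\right)\sum_{I\subseteq\{1,\dots,\ell\}}(-1)^{|I|}F_I(d_1,\dots,d_\ell),$$ where $(d_1,\dots,d_\ell)$ runs over all tuples with $d_i\mid p_i-1$ for each $i$.
   Context: $\phi$ is Euler's totient function. Given $d_i\mid p_i-1$ ($i=1,\dots,\ell$) and a nonempty $J\subseteq\{1,\dots,\ell\}$, let $L_J=\mathrm{lcm}\{(p_i-1)/d_i: i\in J\}$, $P_J=\prod_{i\in J}(p_i-1)$, and let $\alpha_J=L_J$ if there is an integer $c$ with $c\,d_i\equiv\frac{p_i-1}{2}\pmod{p_i-1}$ for all $i\in J$, and $\alpha_J=2L_J$ otherwise. (For $|J|=1$, $J=\{i\}$, this gives $\alpha_J=(p_i-1)/\gcd(d_i,\frac{p_i-1}{2})$.) Put $f_J(x)=\left(1+x^{\alpha_J}\right)^{P_J/\alpha_J}$. For $I\subseteq\{1,\dots,\ell\}$ define $F_I(d_1,\dots,d_\ell)=\prod_{\emptyset\ne J\subseteq\{1,\dots,\ell\}\setminus I}f_J(x)$ (so $F_{\{1,\dots,\ell\}}=1$). For a finite group $\mathcal{A}$ with identity $e$, let $G(\mathcal{A})=\{\Omega\subseteq\mathcal{A}:\Omega^{-1}=\Omega,\ \langle\Omega\rangle=\mathcal{A},\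 e\notin\Omega\}$; for $k\ge1$ let $a^w_k(\mathcal{A})$ be the number of orbits of $\mathrm{Aut}(\mathcal{A})$ (acting by $\alpha\cdot\Omega=\alpha(\Omega)$) on $\{\Omega\in G(\mathcal{A}):|\Omega|=k\}$ (the number of weak equivalence classes of Cayley graphs of $\mathcal{A}$ of degree $k$), and $\Psi^w_{\mathcal{A}}(x)=\sum_{k=1}^{|\mathcal{A}|-1}a^w_k(\mathcal{A})x^k$. *)

theory Defs
  imports "HOL-Algebra.Elementary_Groups" "HOL-Algebra.Generated_Groups"
    "HOL-Computational_Algebra.Polynomial" "HOL-Number_Theory.Number_Theory"
    "HOL-Library.FuncSet"
begin

definition cayley_sets :: "('a, 'b) monoid_scheme \<Rightarrow> 'a set set" where
  "cayley_sets A = {\<Omega>. \<Omega> \<subseteq> carrier A \<and> (\<lambda>x. inv\<^bsub>A\<^esub> x) ` \<Omega> = \<Omega>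
       \<and> generate A \<Omega> = carrier A \<and> one A \<notin> \<Omega>}"

definition weak_count :: "('a, 'b) monoid_scheme \<Rightarrow> nat \<Rightarrow> nat" where
  "weak_count A k = card ((\<lambda>\<Omega>. {\<alpha> ` \<Omega> | \<alpha>. \<alpha> \<in> iso A A})
       ` {\<Omega> \<in> cayley_sets A. card \<Omega> = k})"

definition Psi_w :: "('a, 'b) monoid_scheme \<Rightarrow> rat poly" where
  "Psi_w A = (\<Sum>k\<in>{1..card (carrier A) - 1}. Polynomial.monom (of_nat (weak_count A k)) k)"

definition L_J :: "(nat \<Rightarrow> nat) \<Rightarrow> (nat \<Rightarrow> nat) \<Rightarrow> nat set \<Rightarrow> nat" where
  "L_J p d J = Lcm ((\<lambda>i. (p i - 1) div d i) ` J)"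

definition P_J :: "(nat \<Rightarrow> nat) \<Rightarrow> nat set \<Rightarrow> nat" where
  "P_J p J = (\<Prod>i\<in>J. p i - 1)"

definition alpha_J :: "(nat \<Rightarrow> nat) \<Rightarrow> (nat \<Rightarrow> nat) \<Rightarrow> nat set \<Rightarrow> nat" where
  "alpha_J p d J =
     (if \<exists>c::int. \<forall>i\<in>J. [c * int (d i) = int ((p i - 1) div 2)] (mod int (p i - 1))
      then L_J p d J else 2 * L_J p d J)"

definition f_J :: "(nat \<Rightarrow> nat) \<Rightarrow> (nat \<Rightarrow> nat) \<Rightarrow> nat set \<Rightarrow> rat poly" where
  "f_J p d J = (1 + Polynomial.monom 1 (alpha_J p d J)) ^ (P_J p J div alpha_J p d J)"

definition F_I :: "nat \<Rightarrow> (nat \<Rightarrow> nat) \<Rightarrow> (nat \<Rightarrow> nat) \<Rightarrow> nat set \<Rightarrow> rat poly" where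
  "F_I l p d I = (\<Prod>J\<in>{J. J \<subseteq> {1..l} - I \<and> J \<noteq> {}}. f_J p d J)"

end

theory Submission
  imports Defs "HOL-Algebra.Group_Action"
begin

text \<open>
  By Burnside's lemma, \<open>\<phi>(n) \<Psi>(x)\<close> is the sum over all units \<open>u\<close> modulo \<open>n\<close> of the generating
  function of the symmetric generating sets fixed by \<open>u\<close>. A set generates iff for every \<open>i\<close> it
  contains an element prime to \<open>p\<^sub>i\<close>, so inclusion--exclusion over \<open>I\<close> reduces to sets of nonzero
  multiples of all \<open>p\<^sub>i\<close> with \<open>i \<in> I\<close>. Such a set is fixed by \<open>u\<close> and by negation iff it is a union of
  orbits of \<open>\<langle>u, -1\<rangle>\<close>. On the stratum of elements prime to \<open>p\<^sub>i\<close> exactly for \<open>i \<in> J\<close>, which has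
  \<open>P\<^sub>J\<close> elements, every orbit has the size of the group generated by \<open>-1\<close> and \<open>u\<close> modulo
  the primes in \<open>J\<close>. This is \<open>\<alpha>\<^sub>J\<close>, where \<open>d\<^sub>i = (p\<^sub>i - 1) / ord(u mod p\<^sub>i)\<close>: writing \<open>m\<close> for the
  order of \<open>u\<close> modulo \<open>p\<^sub>i\<close>, both \<open>u\<^sup>c = -1\<close> and \<open>c d\<^sub>i = (p\<^sub>i - 1) / 2\<close> modulo \<open>p\<^sub>i - 1\<close> say that
  \<open>m\<close> divides \<open>2 c\<close> but not \<open>c\<close>, so the choice of primitive roots is irrelevant.
  By the Chinese remainder theorem exactly \<open>\<Prod>\<^sub>i \<phi>((p\<^sub>i - 1) / d\<^sub>i)\<close> units share the tuple \<open>d\<close>.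
\<close>

section \<open>Burnside counting of Cayley sets\<close>

text \<open>\<open>iso G G\<close> leaves values off the carrier arbitrary, while
  \<open>auto G\<close> asks for extensional maps. Images of subsets of the carrier cannot see the
  difference, so orbits may be taken in \<open>AutoGroup G\<close>.\<close>

lemma (in group) auto_image_orbit:
  assumes "\<Omega> \<subseteq> carrier G"
  shows "{\<alpha> ` \<Omega> | \<alpha>. \<alpha> \<in> iso G G} = {\<alpha> ` \<Omega> | \<alpha>. \<alpha> \<in> auto G}"
proof (intro equalityI subsetI; clarify)
  fix \<alpha> assume \<alpha>: "\<alpha> \<in> iso G G"
  have "restrict \<alpha> (carrier G) \<in> auto G"
    using \<alpha> by (auto simp: auto_def Bij_def iso_def hom_def bij_betw_def inj_on_def Pi_iff)
  moreover have "\<alpha> ` \<Omega> = restrict \<alpha> (carrier G) ` \<Omega>"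
    using assms by force
  ultimately show "\<exists>\<beta>. \<alpha> ` \<Omega> = \<beta> ` \<Omega> \<and> \<beta> \<in> auto G" by blast
next
  fix \<alpha> assume "\<alpha> \<in> auto G"
  then have "\<alpha> \<in> iso G G" by (auto simp: auto_def Bij_def iso_def)
  then show "\<exists>\<beta>. \<alpha> ` \<Omega> = \<beta> ` \<Omega> \<and> \<beta> \<in> iso G G" by blast
qed

lemma (in group) auto_group_hom: "\<alpha> \<in> auto G \<Longrightarrow> group_hom G G \<alpha>"
  by (simp add: auto_def group_hom_def group_hom_axioms_def is_group)

lemma (in group) auto_image_cayley_sets:
  assumes "\<alpha> \<in> auto G" "\<Omega> \<in> cayley_sets G"
  shows "\<alpha> ` \<Omega> \<in> cayley_sets G"
proof -
  interpret \<alpha>: group_hom G G \<alpha> by (rule auto_group_hom [OF assms(1)])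
  have bij: "bij_betw \<alpha> (carrier G) (carrier G)" using assms(1) by (simp add: auto_def Bij_def)
  have \<Omega>: "\<Omega> \<subseteq> carrier G" "(\<lambda>x. inv x) ` \<Omega> = \<Omega>" "generate G \<Omega> = carrier G" "\<one> \<notin> \<Omega>"
    using assms(2) by (auto simp: cayley_sets_def)
  have "(\<lambda>x. inv x) ` \<alpha> ` \<Omega> = \<alpha> ` (\<lambda>x. inv x) ` \<Omega>"
    unfolding image_image by (rule image_cong) (use \<Omega>(1) in auto)
  moreover have "generate G (\<alpha> ` \<Omega>) = carrier G"
    using \<alpha>.generate_img [OF \<Omega>(1)] bij \<Omega>(3) by (simp add: bij_betw_def)
  moreover have "\<one> \<notin> \<alpha> ` \<Omega>"
  proof
    assume "\<one> \<in> \<alpha> ` \<Omega>"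
    then obtain x where "x \<in> \<Omega>" "\<one> = \<alpha> x" by (rule imageE)
    have "\<alpha> x = \<alpha> \<one>" by (rule trans [OF sym [OF \<open>\<one> = \<alpha> x\<close>] sym [OF \<alpha>.hom_one]])
    then have "x = \<one>"
      using bij_betw_imp_inj_on [OF bij] \<open>x \<in> \<Omega>\<close> \<Omega>(1) by (meson inj_onD one_closed subsetD)
    with \<open>x \<in> \<Omega>\<close> \<Omega>(4) show False by simp
  qed
  moreover have "\<alpha> ` \<Omega> \<subseteq> carrier G" using bij \<Omega>(1) by (auto simp: bij_betw_def)
  ultimately show ?thesis using \<Omega>(2) by (simp add: cayley_sets_def)
qed

text \<open>The sets are sorted by cardinality because \<open>weak_count\<close> counts orbits for
  one \<open>k\<close> at a time. The action is cut off outside \<open>E k\<close> since elements of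
  \<open>BijGroup\<close> are extensional.\<close>

lemma (in group) auto_acts_on_cayley_sets:
  defines "E \<equiv> \<lambda>k. {\<Omega> \<in> cayley_sets G. card \<Omega> = k}"
  shows "group_action (AutoGroup G) (E k) (\<lambda>\<alpha>. \<lambda>\<Omega>\<in>E k. \<alpha> ` \<Omega>)"
proof -
  define \<phi> where "\<phi> = (\<lambda>\<alpha> :: 'a \<Rightarrow> 'a. \<lambda>\<Omega>\<in>E k. \<alpha> ` \<Omega>)"
  interpret Aut: group "AutoGroup G" by (rule AutoGroup)
  have carr: "carrier (AutoGroup G) = auto G" by (simp add: AutoGroup_def)
  have mult: "\<alpha> \<otimes>\<^bsub>AutoGroup G\<^esub> \<beta> = compose (carrier G) \<alpha> \<beta>" if "\<alpha> \<in> auto G" "\<beta> \<in> auto G" for \<alpha> \<beta>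
    using that by (simp add: AutoGroup_def BijGroup_def auto_def)
  have one: "\<one>\<^bsub>AutoGroup G\<^esub> = (\<lambda>x\<in>carrier G. x)" by (simp add: AutoGroup_def BijGroup_def)
  have sub: "\<Omega> \<subseteq> carrier G" if "\<Omega> \<in> E k" for \<Omega> using that by (auto simp: E_def cayley_sets_def)
  have img: "\<alpha> ` \<Omega> \<in> E k" if "\<alpha> \<in> auto G" "\<Omega> \<in> E k" for \<alpha> \<Omega>
  proof -
    have "inj_on \<alpha> \<Omega>"
      using that sub [OF that(2)] by (auto simp: auto_def Bij_def bij_betw_def intro: inj_on_subset)
    then show ?thesis
      using that auto_image_cayley_sets by (auto simp: E_def card_image)
  qed
  have comp: "compose (carrier G) \<alpha> \<beta> ` \<Omega> = \<alpha> ` \<beta> ` \<Omega>" if "\<Omega> \<in> E k" for \<alpha> \<beta> :: "'a \<Rightarrow> 'a" and \<Omega>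
    using sub [OF that] by (force simp: compose_def image_image)
  have Bij: "\<phi> \<alpha> \<in> Bij (E k)" if \<alpha>: "\<alpha> \<in> auto G" for \<alpha>
  proof -
    \<comment> \<open>The image map of the inverse automorphism is the two-sided inverse. The
      composites are the identity only on the carrier, which contains every member of
      \<open>E k\<close>.\<close>
    define \<beta> where "\<beta> = inv\<^bsub>AutoGroup G\<^esub> \<alpha>"
    have \<beta>: "\<beta> \<in> auto G" using Aut.inv_closed \<alpha> by (simp add: \<beta>_def carr)
    have id: "(\<lambda>x\<in>carrier G. x) ` \<Omega> = \<Omega>" if "\<Omega> \<in> E k" for \<Omega> using sub [OF that] by force
    have "compose (carrier G) \<alpha> \<beta> = (\<lambda>x\<in>carrier G. x)" "compose (carrier G) \<beta> \<alpha> = (\<lambda>x\<in>carrier G. x)"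
      using Aut.r_inv Aut.l_inv \<alpha> \<beta> mult one carr by (metis \<beta>_def)+
    then have "\<alpha> ` \<beta> ` \<Omega> = \<Omega>" "\<beta> ` \<alpha> ` \<Omega> = \<Omega>" if "\<Omega> \<in> E k" for \<Omega>
      using comp [OF that] id [OF that] by metis+
    then have "bij_betw (\<phi> \<alpha>) (E k) (E k)"
      using img \<alpha> \<beta> by (intro bij_betwI [of _ _ _ "\<lambda>\<Omega>. \<beta> ` \<Omega>"]) (auto simp: \<phi>_def)
    then show ?thesis by (simp add: Bij_def \<phi>_def)
  qed
  have "\<phi> \<in> hom (AutoGroup G) (BijGroup (E k))"
  proof (rule homI)
    fix \<alpha> \<beta> assume ab: "\<alpha> \<in> carrier (AutoGroup G)" "\<beta> \<in> carrier (AutoGroup G)"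
    have "\<phi> (compose (carrier G) \<alpha> \<beta>) = compose (E k) (\<phi> \<alpha>) (\<phi> \<beta>)"
    proof
      fix \<Omega> show "\<phi> (compose (carrier G) \<alpha> \<beta>) \<Omega> = compose (E k) (\<phi> \<alpha>) (\<phi> \<beta>) \<Omega>"
        using ab img [of \<beta> \<Omega>] comp [of \<Omega> \<alpha> \<beta>]
        by (cases "\<Omega> \<in> E k") (simp_all add: \<phi>_def compose_def [of "E k"] carr)
    qed
    then show "\<phi> (\<alpha> \<otimes>\<^bsub>AutoGroup G\<^esub> \<beta>) = \<phi> \<alpha> \<otimes>\<^bsub>BijGroup (E k)\<^esub> \<phi> \<beta>"
      using ab Bij by (simp add: mult carr BijGroup_def)
  qed (use Bij in \<open>simp add: carr BijGroup_def\<close>)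
  then show ?thesis
    by (simp add: group_action_def group_hom_def group_hom_axioms_def group_BijGroup Aut.is_group \<phi>_def)
qed

lemma (in group) finite_cayley_sets: "finite (carrier G) \<Longrightarrow> finite (cayley_sets G)"
  by (rule finite_subset [of _ "Pow (carrier G)"]) (auto simp: cayley_sets_def)

lemma (in group) finite_auto:
  assumes "finite (carrier G)"
  shows "finite (auto G)"
proof (rule finite_subset)
  show "auto G \<subseteq> carrier G \<rightarrow>\<^sub>E carrier G"
    by (auto simp: auto_def Bij_def PiE_def dest: bij_betw_apply)
  show "finite (carrier G \<rightarrow>\<^sub>E carrier G)"
    using assms by (intro finite_PiE) auto
qed

text \<open>The classes counted by \<open>weak_count\<close> are literally the orbits of the action
  above, so Burnside's lemma applies.\<close>

lemma (in group) weak_count_burnside: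
  assumes "finite (carrier G)"
  shows "weak_count G k * card (auto G)
    = (\<Sum>\<alpha>\<in>auto G. card {\<Omega> \<in> cayley_sets G. card \<Omega> = k \<and> \<alpha> ` \<Omega> = \<Omega>})"
proof -
  define E where "E = {\<Omega> \<in> cayley_sets G. card \<Omega> = k}"
  define \<phi> where "\<phi> = (\<lambda>\<alpha> :: 'a \<Rightarrow> 'a. \<lambda>\<Omega>\<in>E. \<alpha> ` \<Omega>)"
  interpret group_action "AutoGroup G" E \<phi>
    unfolding E_def \<phi>_def by (rule auto_acts_on_cayley_sets)
  have carr: "carrier (AutoGroup G) = auto G" by (simp add: AutoGroup_def)
  have "orbit (AutoGroup G) \<phi> \<Omega> = {\<alpha> ` \<Omega> | \<alpha>. \<alpha> \<in> iso G G}" if "\<Omega> \<in> E" for \<Omega>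
  proof -
    have "\<Omega> \<subseteq> carrier G" using that by (auto simp: E_def cayley_sets_def)
    then show ?thesis using that by (simp add: auto_image_orbit orbit_def \<phi>_def carr)
  qed
  then have "orbits (AutoGroup G) E \<phi> = (\<lambda>\<Omega>. {\<alpha> ` \<Omega> | \<alpha>. \<alpha> \<in> iso G G}) ` E"
    unfolding orbits_def Setcompr_eq_image by (rule image_cong [OF refl])
  then have "weak_count G k = card (orbits (AutoGroup G) E \<phi>)"
    by (simp add: weak_count_def E_def)
  moreover have "invariants E \<phi> \<alpha> = {\<Omega> \<in> cayley_sets G. card \<Omega> = k \<and> \<alpha> ` \<Omega> = \<Omega>}" for \<alpha>
    by (auto simp: invariants_def \<phi>_def E_def)
  ultimately show ?thesis
    using burnside finite_auto [OF assms] finite_cayley_sets [OF assms]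
    by (simp add: carr order_def E_def)
qed

text \<open>Exchanging the sums over \<open>k\<close> and \<alpha> turns counts of fixed sets into
  their generating function. The range of \<open>k\<close> loses nothing: a Cayley set omits the
  identity, and in a nontrivial group it is nonempty.\<close>

lemma (in group) Psi_w_burnside:
  assumes "finite (carrier G)" "card (carrier G) > 1"
  shows "Polynomial.smult (of_nat (card (auto G))) (Psi_w G)
    = (\<Sum>\<alpha>\<in>auto G. \<Sum>\<Omega> | \<Omega> \<in> cayley_sets G \<and> \<alpha> ` \<Omega> = \<Omega>. Polynomial.monom 1 (card \<Omega>))"
proof -
  let ?K = "{1..card (carrier G) - 1}"
  have range: "card \<Omega> \<in> ?K" if "\<Omega> \<in> cayley_sets G" for \<Omega>
  proof -
    have \<Omega>: "\<Omega> \<subseteq> carrier G - {\<one>}" "generate G \<Omega> = carrier G"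
      using that by (auto simp: cayley_sets_def)
    have "card \<Omega> \<le> card (carrier G) - 1"
      using card_mono [OF _ \<Omega>(1)] assms(1) by (simp add: card_Diff_singleton)
    moreover have "\<Omega> \<noteq> {}" using \<Omega>(2) assms(2) generate_empty by (metis One_nat_def card_1_singleton_iff less_irrefl)
    moreover have "finite \<Omega>" using \<Omega>(1) assms(1) finite_subset by blast
    ultimately show ?thesis by (simp add: Suc_le_eq card_gt_0_iff)
  qed
  have fin: "finite {\<Omega> \<in> cayley_sets G. \<alpha> ` \<Omega> = \<Omega>}" for \<alpha>
    using finite_cayley_sets [OF assms(1)] by simp
  have "Polynomial.smult (of_nat (card (auto G))) (Psi_w G)
      = (\<Sum>k\<in>?K. Polynomial.monom (of_nat (weak_count G k * card (auto G))) k)"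
    using sum_distrib_left [of "[:of_nat (card (auto G)) :: rat:]" _ ?K]
    by (simp add: Psi_w_def smult_monom mult.commute del: One_nat_def)
  also have "\<dots> = (\<Sum>k\<in>?K. \<Sum>\<alpha>\<in>auto G.
      Polynomial.monom (of_nat (card {\<Omega> \<in> cayley_sets G. card \<Omega> = k \<and> \<alpha> ` \<Omega> = \<Omega>})) k)"
    by (simp only: weak_count_burnside [OF assms(1)] of_nat_sum monom_sum)
  also have "\<dots> = (\<Sum>\<alpha>\<in>auto G. \<Sum>k\<in>?K.
      Polynomial.monom (of_nat (card {\<Omega> \<in> cayley_sets G. card \<Omega> = k \<and> \<alpha> ` \<Omega> = \<Omega>})) k)"
    by (rule sum.swap)
  also have "\<dots> = (\<Sum>\<alpha>\<in>auto G. \<Sum>k\<in>?K.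
      \<Sum>\<Omega> | \<Omega> \<in> {\<Omega> \<in> cayley_sets G. \<alpha> ` \<Omega> = \<Omega>} \<and> card \<Omega> = k. Polynomial.monom 1 (card \<Omega>))"
  proof (intro sum.cong refl)
    fix \<alpha> k
    have "{\<Omega>. \<Omega> \<in> {\<Omega> \<in> cayley_sets G. \<alpha> ` \<Omega> = \<Omega>} \<and> card \<Omega> = k}
        = {\<Omega> \<in> cayley_sets G. card \<Omega> = k \<and> \<alpha> ` \<Omega> = \<Omega>}" by blast
    moreover have "(\<Sum>\<Omega> | \<Omega> \<in> cayley_sets G \<and> card \<Omega> = k \<and> \<alpha> ` \<Omega> = \<Omega>. Polynomial.monom (1::rat) (card \<Omega>))
        = (\<Sum>\<Omega> | \<Omega> \<in> cayley_sets G \<and> card \<Omega> = k \<and> \<alpha> ` \<Omega> = \<Omega>. Polynomial.monom 1 k)"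
      by (rule sum.cong) auto
    ultimately show "Polynomial.monom (of_nat (card {\<Omega> \<in> cayley_sets G. card \<Omega> = k \<and> \<alpha> ` \<Omega> = \<Omega>})) k
        = (\<Sum>\<Omega> | \<Omega> \<in> {\<Omega> \<in> cayley_sets G. \<alpha> ` \<Omega> = \<Omega>} \<and> card \<Omega> = k. Polynomial.monom (1::rat) (card \<Omega>))"
      by (simp add: of_nat_poly smult_monom)
  qed
  also have "\<dots> = (\<Sum>\<alpha>\<in>auto G. \<Sum>\<Omega> | \<Omega> \<in> cayley_sets G \<and> \<alpha> ` \<Omega> = \<Omega>. Polynomial.monom 1 (card \<Omega>))"
    by (intro sum.cong refl sum.group fin) (use range in auto)
  finally show ?thesis .
qed

section \<open>Generating functions of saturated sets\<close>

text \<open>The hypotheses make \<open>cls\<close> the class map of an equivalence relation on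
  \<open>X\<close>. Saturated sets correspond to subfamilies of classes by taking unions, and sizes
  of classes add, so the sum is the expanded product.\<close>

lemma sum_monom_saturated:
  fixes cls :: "'a \<Rightarrow> 'a set"
  assumes "finite X"
    and self: "\<And>x. x \<in> X \<Longrightarrow> x \<in> cls x"
    and sub: "\<And>x. x \<in> X \<Longrightarrow> cls x \<subseteq> X"
    and eq: "\<And>x y. x \<in> X \<Longrightarrow> y \<in> cls x \<Longrightarrow> cls y = cls x"
  shows "(\<Sum>\<Omega> | \<Omega> \<subseteq> X \<and> (\<forall>x\<in>\<Omega>. cls x \<subseteq> \<Omega>). Polynomial.monom (1::'b::comm_semiring_1) (card \<Omega>))
    = (\<Prod>C\<in>cls ` X. 1 + Polynomial.monom 1 (card C))"
proof -
  have disj: "C \<inter> D = {}" if "C \<in> cls ` X" "D \<in> cls ` X" "C \<noteq> D" for C D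
  proof (rule ccontr)
    assume "C \<inter> D \<noteq> {}"
    then obtain z where z: "z \<in> C" "z \<in> D" by blast
    from that obtain x y where "x \<in> X" "C = cls x" "y \<in> X" "D = cls y" by blast
    with z eq [of x z] eq [of y z] \<open>C \<noteq> D\<close> show False by simp
  qed
  have card: "card (\<Union>\<C>) = (\<Sum>C\<in>\<C>. card C)" if \<C>: "\<C> \<subseteq> cls ` X" for \<C>
  proof (rule card_Union_disjoint)
    show "pairwise disjnt \<C>"
      by (intro pairwiseI) (simp add: disjnt_def disj subsetD [OF \<C>])
    fix C assume "C \<in> \<C>"
    then obtain x where "x \<in> X" "C = cls x" using \<C> by blast
    then show "finite C" using sub [of x] finite_subset [OF _ assms(1)] by simp
  qed
  have "(\<Sum>\<Omega> | \<Omega> \<subseteq> X \<and> (\<forall>x\<in>\<Omega>. cls x \<subseteq> \<Omega>). Polynomial.monom (1::'b) (card \<Omega>))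
      = (\<Sum>\<C>\<in>Pow (cls ` X). Polynomial.monom 1 (card (\<Union>\<C>)))"
  proof (rule sum.reindex_bij_witness [where i = Union and j = "\<lambda>\<Omega>. cls ` \<Omega>"])
    fix \<Omega> assume \<Omega>: "\<Omega> \<in> {\<Omega>. \<Omega> \<subseteq> X \<and> (\<forall>x\<in>\<Omega>. cls x \<subseteq> \<Omega>)}"
    show "\<Union> (cls ` \<Omega>) = \<Omega>" using \<Omega> self by blast
    then show "Polynomial.monom (1::'b) (card (\<Union> (cls ` \<Omega>))) = Polynomial.monom 1 (card \<Omega>)" by simp
    show "cls ` \<Omega> \<in> Pow (cls ` X)" using \<Omega> by blast
  next
    fix \<C> assume \<C>: "\<C> \<in> Pow (cls ` X)"
    show "cls ` \<Union> \<C> = \<C>"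
    proof (intro equalityI subsetI)
      fix C assume "C \<in> cls ` \<Union> \<C>"
      then obtain D x where D: "D \<in> \<C>" "x \<in> D" "C = cls x" by blast
      with \<C> obtain y where "y \<in> X" "D = cls y" by blast
      with D eq [of y x] show "C \<in> \<C>" by simp
    next
      fix C assume C: "C \<in> \<C>"
      then obtain x where "x \<in> X" "C = cls x" using \<C> by blast
      with C self [of x] show "C \<in> cls ` \<Union> \<C>" by blast
    qed
    show "\<Union> \<C> \<in> {\<Omega>. \<Omega> \<subseteq> X \<and> (\<forall>x\<in>\<Omega>. cls x \<subseteq> \<Omega>)}"
    proof (intro CollectI conjI ballI)
      show "\<Union> \<C> \<subseteq> X" using \<C> sub by fast
      fix x assume "x \<in> \<Union> \<C>"
      then obtain D where D: "D \<in> \<C>" "x \<in> D" by blast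
      with \<C> obtain y where "y \<in> X" "D = cls y" by blast
      with D eq [of y x] show "cls x \<subseteq> \<Union> \<C>" by auto
    qed
  qed
  also have "\<dots> = (\<Sum>\<C>\<in>Pow (cls ` X). \<Prod>C\<in>\<C>. Polynomial.monom 1 (card C))"
    by (intro sum.cong refl) (simp add: card monom_altdef power_sum)
  also have "\<dots> = (\<Prod>C\<in>cls ` X. Polynomial.monom 1 (card C) + 1)"
    using assms(1) by (simp add: prod_add)
  finally show ?thesis by (simp add: add.commute)
qed

text \<open>The classes partition \<open>X\<close>, so the division is exact. This will yield the
  exponent in \<open>f_J\<close>.\<close>

lemma card_classes_uniform:
  assumes "finite X"
    and self: "\<And>x. x \<in> X \<Longrightarrow> x \<in> cls x"
    and sub: "\<And>x. x \<in> X \<Longrightarrow> cls x \<subseteq> X"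
    and eq: "\<And>x y. x \<in> X \<Longrightarrow> y \<in> cls x \<Longrightarrow> cls y = cls x"
    and size: "\<And>x. x \<in> X \<Longrightarrow> card (cls x) = a"
    and "a > 0"
  shows "card (cls ` X) = card X div a"
proof -
  have "a * card (cls ` X) = card (\<Union> (cls ` X))"
  proof (rule card_partition)
    have "cls ` X \<subseteq> Pow X" using sub by blast
    then show "finite (cls ` X)" "finite (\<Union> (cls ` X))"
      using \<open>finite X\<close> by (auto intro: finite_subset [of _ X])
    show "card C = a" if "C \<in> cls ` X" for C using that size by auto
    fix C D assume "C \<in> cls ` X" "D \<in> cls ` X" and "C \<noteq> D"
    then obtain x y where xy: "x \<in> X" "C = cls x" "y \<in> X" "D = cls y" by blast
    show "C \<inter> D = {}"
    proof (rule ccontr)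
      assume "C \<inter> D \<noteq> {}"
      then obtain z where "z \<in> C" "z \<in> D" by blast
      with xy eq [of x z] eq [of y z] \<open>C \<noteq> D\<close> show False by simp
    qed
  qed
  also have "\<Union> (cls ` X) = X" using self sub by fast
  finally show ?thesis using \<open>a > 0\<close> by (metis nonzero_mult_div_cancel_left not_gr_zero)
qed

section \<open>Inclusion-exclusion\<close>

text \<open>This is the expansion of the product of the factors \<open>1 - 1\<close> over
  \<open>B\<close>.\<close>

lemma sum_alternating_Pow:
  assumes "finite B"
  shows "(\<Sum>I\<in>Pow B. (-1) ^ card I :: 'a::comm_ring_1) = (if B = {} then 1 else 0)"
  using prod_diff_conv_sum [OF assms, of "\<lambda>_. 1" "\<lambda>_. 1 :: 'a"] assms
  by (simp add: card_gt_0_iff power_0_left)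

text \<open>After exchanging the sums, a fixed \<open>x\<close> occurs exactly for the
  \<open>I\<close> inside \<open>{i\<in>K. P i x}\<close>, and the alternating sum over these
  vanishes unless \<open>x\<close> has none of the properties.\<close>

lemma sum_inclusion_exclusion:
  fixes w :: "'a \<Rightarrow> 'b::comm_ring_1"
  assumes "finite S" "finite K"
  shows "(\<Sum>x | x \<in> S \<and> (\<forall>i\<in>K. \<not> P i x). w x)
    = (\<Sum>I\<in>Pow K. (-1) ^ card I * (\<Sum>x | x \<in> S \<and> (\<forall>i\<in>I. P i x). w x))"
proof -
  have "(\<Sum>I\<in>Pow K. (-1) ^ card I * (\<Sum>x | x \<in> S \<and> (\<forall>i\<in>I. P i x). w x))
      = (\<Sum>I\<in>Pow K. \<Sum>x\<in>S. if \<forall>i\<in>I. P i x then (-1) ^ card I * w x else 0)"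
    using assms(1) by (auto simp: sum_distrib_left sum.inter_filter intro!: sum.cong)
  also have "\<dots> = (\<Sum>x\<in>S. \<Sum>I\<in>Pow K. if \<forall>i\<in>I. P i x then (-1) ^ card I * w x else 0)"
    by (rule sum.swap)
  also have "\<dots> = (\<Sum>x\<in>S. \<Sum>I\<in>Pow {i\<in>K. P i x}. (-1) ^ card I * w x)"
  proof (rule sum.cong [OF refl])
    fix x
    have "Pow {i\<in>K. P i x} = {I \<in> Pow K. \<forall>i\<in>I. P i x}" by blast
    then show "(\<Sum>I\<in>Pow K. if \<forall>i\<in>I. P i x then (-1) ^ card I * w x else 0)
        = (\<Sum>I\<in>Pow {i\<in>K. P i x}. (-1) ^ card I * w x)"
      using assms(2) by (simp only: sum.inter_filter finite_Pow_iff)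
  qed
  also have "\<dots> = (\<Sum>x\<in>S. if \<forall>i\<in>K. \<not> P i x then w x else 0)"
    using assms(2) by (intro sum.cong refl) (auto simp: sum_alternating_Pow simp flip: sum_distrib_right)
  finally show ?thesis using assms(1) by (simp add: sum.inter_filter)
qed

section \<open>Automorphisms and generators of \<open>\<int>/n\<int>\<close>\<close>

text \<open>An endomorphism of a cyclic group is determined by the image \<open>u\<close> of 1, and
  it is onto only if \<open>u\<close> is a unit. As \<open>n > 1\<close>, \<open>totatives n\<close>
  holds exactly one representative below \<open>n\<close> of each unit.\<close>

lemma auto_integer_mod_group:
  assumes "n > 1"
  shows "bij_betw (\<lambda>u. \<lambda>x\<in>{0..<int n}. int u * x mod int n) (totatives n) (auto (integer_mod_group n))"
proof -
  let ?Z = "integer_mod_group n"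
  interpret Z: group ?Z by simp
  have carr: "carrier ?Z = {0..<int n}" using assms by (simp add: carrier_integer_mod_group)
  define \<mu> where "\<mu> = (\<lambda>u::nat. \<lambda>x\<in>{0..<int n}. int u * x mod int n)"
  have "inj_on \<mu> (totatives n)"
  proof (rule inj_onI)
    fix u v assume uv: "u \<in> totatives n" "v \<in> totatives n" "\<mu> u = \<mu> v"
    then have "u < n" "v < n" using assms totatives_less by auto
    moreover have "\<mu> u 1 = \<mu> v 1" using uv(3) by simp
    ultimately show "u = v" using assms by (simp add: \<mu>_def)
  qed
  moreover have "\<mu> u \<in> auto ?Z" if u: "u \<in> totatives n" for u
  proof -
    have cop: "coprime (int u) (int n)" using u by (simp add: totatives_def)
    have inj: "inj_on (\<mu> u) {0..<int n}"
    proof (rule inj_onI)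
      fix x y assume xy: "x \<in> {0..<int n}" "y \<in> {0..<int n}" "\<mu> u x = \<mu> u y"
      then have "[int u * x = int u * y] (mod int n)" by (simp add: \<mu>_def cong_def)
      then have "[x = y] (mod int n)" using cop cong_mult_lcancel by blast
      then show "x = y" using xy by (simp add: cong_def)
    qed
    have range: "\<mu> u ` {0..<int n} \<subseteq> {0..<int n}" using assms by (auto simp: \<mu>_def)
    then have "bij_betw (\<mu> u) {0..<int n} {0..<int n}"
      using inj by (simp add: bij_betw_def endo_inj_surj)
    moreover have "\<mu> u \<in> hom ?Z ?Z"
      using range assms by (intro homI) (auto simp: carr \<mu>_def distrib_left mod_simps)
    ultimately show ?thesis by (simp add: auto_def Bij_def carr \<mu>_def)
  qed
  moreover have "\<alpha> \<in> \<mu> ` totatives n" if \<alpha>: "\<alpha> \<in> auto ?Z" for \<alpha>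
  proof -
    interpret \<alpha>: group_hom ?Z ?Z \<alpha>
      using \<alpha> by (simp add: auto_def group_hom_def group_hom_axioms_def)
    define u where "u = nat (\<alpha> 1)"
    have ext: "\<alpha> \<in> extensional {0..<int n}" and bij: "bij_betw \<alpha> {0..<int n} {0..<int n}"
      using \<alpha> by (auto simp: auto_def Bij_def carr)
    have one: "1 \<in> carrier ?Z" using assms by (simp add: carr)
    then have u: "\<alpha> 1 = int u" "u < n"
      using \<alpha>.hom_closed [OF one] by (auto simp: u_def carr)
    have val: "\<alpha> x = int u * x mod int n" if "x \<in> {0..<int n}" for x
    proof -
      \<comment> \<open>In the additive group, \<open>x\<close> is the power of 1 with exponent
        \<open>nat x\<close>.\<close>
      have "\<alpha> (1 [^]\<^bsub>?Z\<^esub> nat x) = \<alpha> 1 [^]\<^bsub>?Z\<^esub> nat x" by (rule \<alpha>.hom_nat_pow [OF one])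
      then show ?thesis using that u(1) by (simp add: mult.commute)
    qed
    \<comment> \<open>A preimage of 1 is an inverse of \<open>u\<close> modulo
      \<open>n\<close>.\<close>
    have "1 \<in> \<alpha> ` {0..<int n}" using bij one by (simp add: bij_betw_def carr)
    then obtain x where "x \<in> {0..<int n}" "int u * x mod int n = 1" using val by force
    then have "[int u * x = 1] (mod int n)" using assms by (simp add: cong_def)
    then have "coprime (int u) (int n)" by (metis coprime_iff_invertible_int)
    moreover have "u > 0" using calculation assms by (cases u) auto
    ultimately have "u \<in> totatives n" using u(2) by (simp add: totatives_def)
    moreover have "\<alpha> = \<mu> u" using ext val by (auto simp: \<mu>_def extensional_def fun_eq_iff)
    ultimately show ?thesis by blast
  qed
  ultimately show ?thesis by (auto simp: bij_betw_def \<mu>_def)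
qed

text \<open>The maximal subgroups consist of the multiples of a prime divisor of \<open>n\<close>.
  Conversely, the integers with residue in the generated subgroup are the multiples of some
  \<open>g\<close>, and a prime factor of \<open>g\<close> would divide \<open>n\<close> and all of
  \<Omega>.\<close>

lemma generate_integer_mod_group_iff:
  assumes "n > 1" "\<Omega> \<subseteq> {0..<int n}"
  shows "generate (integer_mod_group n) \<Omega> = {0..<int n} \<longleftrightarrow>
    (\<forall>q. prime q \<and> q dvd n \<longrightarrow> (\<exists>x\<in>\<Omega>. \<not> int q dvd x))" (is "?H = _ \<longleftrightarrow> ?R")
proof -
  let ?Z = "integer_mod_group n"
  interpret Z: group ?Z by simp
  have carr: "carrier ?Z = {0..<int n}" using assms by (simp add: carrier_integer_mod_group)
  have sub: "subgroup ?H ?Z" using Z.generate_is_subgroup assms by (simp add: carr)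
  show ?thesis
  proof
    assume gen: "?H = {0..<int n}"
    show ?R
    proof (intro allI impI, rule ccontr)
      fix q assume q: "prime q \<and> q dvd n" and "\<not> (\<exists>x\<in>\<Omega>. \<not> int q dvd x)"
      then have \<Omega>: "\<forall>x\<in>\<Omega>. int q dvd x" by blast
      have "int q dvd x" if "x \<in> ?H" for x
        using that
      proof (induction rule: generate.induct)
        case (inv h)
        then have "h \<in> carrier ?Z" using assms carr by blast
        then show ?case using inv \<Omega> q by (simp add: dvd_mod_iff)
      qed (use \<Omega> q in \<open>auto simp: dvd_mod_iff\<close>)
      moreover have "1 \<in> ?H" using gen assms by simp
      ultimately have "int q dvd 1" by blast
      then show False using q by simp
    qed
  next
    assume R: ?R
    \<comment> \<open>The integers with residue in \<open>?H\<close> form an ideal, and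
      \<open>g\<close> is its positive generator. The least value exists because \<open>n\<close>
      qualifies.\<close>
    define g where "g = (LEAST g::nat. g > 0 \<and> int g mod int n \<in> ?H)"
    have "0 \<in> ?H" using subgroup.one_closed [OF sub] by simp
    then have "n > 0 \<and> int n mod int n \<in> ?H" using assms(1) by simp
    then have "g > 0 \<and> int g mod int n \<in> ?H" unfolding g_def by (rule LeastI)
    then have g: "g > 0" "int g mod int n \<in> ?H" by auto
    have g_dvd: "int g dvd z" if z: "z mod int n \<in> ?H" for z
    proof (rule ccontr)
      assume "\<not> int g dvd z"
      then have "z mod int g \<noteq> 0" by (simp add: dvd_eq_mod_eq_0)
      moreover have bounds: "0 \<le> z mod int g" "z mod int g < int g" using g(1) by simp_all
      ultimately have pos: "nat (z mod int g) > 0" by simp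
      \<comment> \<open>Division with remainder: subtracting a multiple of \<open>g\<close> from
        \<open>z\<close> leaves a smaller positive member of the same ideal.\<close>
      have "(int g mod int n) [^]\<^bsub>?Z\<^esub> (- (z div int g)) \<in> ?H"
        by (rule Z.subgroup_int_pow_closed [OF sub g(2)])
      then have "((- (z div int g)) * int g) mod int n \<in> ?H"
        by (simp only: int_pow_integer_mod_group mod_mult_right_eq)
      from subgroup.m_closed [OF sub z this]
      have "(z - (z div int g) * int g) mod int n \<in> ?H"
        by (simp only: mult_integer_mod_group mod_add_eq mult_minus_left add_uminus_conv_diff)
      then have "int (nat (z mod int g)) mod int n \<in> ?H"
        using bounds by (simp add: minus_div_mult_eq_mod)
      with pos have "g \<le> nat (z mod int g)" unfolding g_def by (intro Least_le) simp
      then show False using bounds by linarith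
    qed
    have "g = 1"
    proof (rule ccontr)
      assume "g \<noteq> 1"
      then obtain q where q: "prime q" "q dvd g" using prime_factor_nat by blast
      have "int g dvd int n" using g_dvd [of "int n"] \<open>0 \<in> ?H\<close> by simp
      with q have "q dvd n" by auto
      with R q obtain x where x: "x \<in> \<Omega>" "\<not> int q dvd x" by blast
      have "x \<in> {0..<int n}" using x(1) assms(2) by blast
      then have "x mod int n \<in> ?H" using generate.incl [OF x(1)] by simp
      then have "int g dvd x" by (rule g_dvd)
      with q x show False by (meson dvd_trans of_nat_dvd_iff)
    qed
    then have one: "1 \<in> ?H" using g(2) assms(1) by simp
    have "z \<in> ?H" if "z \<in> {0..<int n}" for z
      using Z.subgroup_int_pow_closed [OF sub one, of z] that by (simp add: int_pow_integer_mod_group)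
    then show "?H = {0..<int n}" using subgroup.subset [OF sub] by (auto simp: carr)
  qed
qed

section \<open>Powers of a unit that are congruent to -1\<close>

text \<open>Both sides say that \<open>z\<close> is an odd multiple of \<open>h\<close>.\<close>

lemma cong_half_iff:
  fixes z h :: int
  assumes "h > 0"
  shows "[z = h] (mod 2 * h) \<longleftrightarrow> 2 * h dvd 2 * z \<and> \<not> 2 * h dvd z"
proof
  assume "[z = h] (mod 2 * h)"
  then obtain t where "z = h + 2 * h * t" by (metis cong_iff_lin cong_sym)
  then have "z = h * (1 + 2 * t)" by (simp add: algebra_simps)
  then show "2 * h dvd 2 * z \<and> \<not> 2 * h dvd z" using assms by (simp add: mult.commute)
next
  assume *: "2 * h dvd 2 * z \<and> \<not> 2 * h dvd z"
  then obtain q where q: "z = h * q" by auto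
  with * have "odd q" by (metis dvd_triv_right mult_dvd_mono dvd_refl mult.commute)
  then have "even (q - 1)" by simp
  then have "h * 2 dvd h * (q - 1)" by (rule mult_dvd_mono [OF dvd_refl])
  then show "[z = h] (mod 2 * h)" by (simp add: cong_iff_dvd_diff q algebra_simps)
qed

text \<open>Modulo an odd prime, -1 is the only square root of 1 besides 1, so the left side says
  that \<open>ord p u\<close> divides \<open>2 * c\<close> but not \<open>c\<close>. Multiplied by
  the cofactor of \<open>ord p u\<close> in \<open>p - 1\<close>, this is the condition of
  \<open>cong_half_iff\<close>.\<close>

lemma power_cong_minus_one_iff:
  fixes p u c :: nat
  assumes "prime p" "odd p" "coprime p u"
  shows "[int u ^ c = -1] (mod int p) \<longleftrightarrow>
    [int c * int ((p - 1) div ord p u) = int ((p - 1) div 2)] (mod int (p - 1))"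
proof -
  define m d h where "m = ord p u" and "d = (p - 1) div ord p u" and "h = (p - 1) div 2"
  have m: "m dvd p - 1" using assms order_divides_totient [of p u] by (simp add: m_def totient_prime)
  then have p1: "p - 1 = m * d" by (simp add: d_def m_def)
  have h: "p - 1 = 2 * h" using assms(2) by (simp add: h_def)
  have "p > 2" using assms prime_ge_2_nat by (metis even_numeral le_neq_implies_less)
  then have pos: "h > 0" "d > 0" using h p1 by (auto intro!: Nat.gr0I)
  have pow: "int p dvd int u ^ k - 1 \<longleftrightarrow> m dvd k" for k
  proof -
    have "[u ^ k = 1] (mod p) \<longleftrightarrow> int p dvd int u ^ k - 1"
      by (metis cong_iff_dvd_diff cong_int_iff of_nat_1 of_nat_power)
    then show ?thesis unfolding ord_divides m_def by blast
  qed
  have primei: "prime (int p)" using assms by simp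
  have "[int u ^ c = -1] (mod int p) \<longleftrightarrow> int p dvd int u ^ c + 1"
    by (simp add: cong_iff_dvd_diff)
  \<comment> \<open>The difference \<open>int u ^ (2 * c) - 1\<close> factors into
    \<open>int u ^ c + 1\<close> and \<open>int u ^ c - 1\<close>, and \<open>p > 2\<close> cannot
    divide both.\<close>
  also have "\<dots> \<longleftrightarrow> int p dvd int u ^ (2 * c) - 1 \<and> \<not> int p dvd int u ^ c - 1"
  proof -
    have "int u ^ (2 * c) - 1 = (int u ^ c + 1) * (int u ^ c - 1)"
      by (simp add: algebra_simps power_mult power2_eq_square flip: power_mult_distrib)
    moreover have "\<not> (int p dvd int u ^ c + 1 \<and> int p dvd int u ^ c - 1)"
    proof
      assume "int p dvd int u ^ c + 1 \<and> int p dvd int u ^ c - 1"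
      then have "int p dvd (int u ^ c + 1) - (int u ^ c - 1)" by (blast intro: dvd_diff)
      then have "int p dvd 2" by simp
      then show False using \<open>p > 2\<close> by (auto dest: zdvd_imp_le)
    qed
    ultimately show ?thesis using primei by (auto simp: prime_dvd_mult_iff)
  qed
  also have "\<dots> \<longleftrightarrow> m dvd 2 * c \<and> \<not> m dvd c" by (simp add: pow)
  also have "\<dots> \<longleftrightarrow> m * d dvd 2 * (c * d) \<and> \<not> m * d dvd c * d"
    using pos by (simp add: mult.assoc [symmetric])
  also have "\<dots> \<longleftrightarrow> 2 * int h dvd 2 * int (c * d) \<and> \<not> 2 * int h dvd int (c * d)"
    using h p1 by (metis of_nat_dvd_iff of_nat_mult of_nat_numeral)
  also have "\<dots> \<longleftrightarrow> [int (c * d) = int h] (mod 2 * int h)"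
    using pos by (simp add: cong_half_iff)
  also have "2 * int h = int (p - 1)" using h by simp
  finally show ?thesis by (simp only: d_def h_def of_nat_mult)
qed

lemma cong_Lcm_iff:
  fixes a b :: nat
  shows "[a = b] (mod Lcm M) \<longleftrightarrow> (\<forall>m\<in>M. [a = b] (mod m))"
  unfolding cong_altdef_nat' Lcm_dvd_iff ..

lemma card_range_periodic:
  fixes h :: "nat \<Rightarrow> 'a"
  assumes "\<And>j k. h j = h k \<longleftrightarrow> [j = k] (mod L)" and "L > 0"
  shows "card (range h) = L"
proof -
  have "range h = h ` {..<L}"
  proof (intro equalityI subsetI)
    fix y assume "y \<in> range h"
    then obtain k where "y = h k" by blast
    also have "h k = h (k mod L)" by (simp add: assms(1) cong_def)
    finally show "y \<in> h ` {..<L}" using \<open>L > 0\<close> by simp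
  qed blast
  moreover have "inj_on h {..<L}" by (rule inj_onI) (simp add: assms(1) cong_def)
  ultimately show ?thesis by (simp add: card_image)
qed

section \<open>Residues modulo a product of distinct odd primes\<close>

locale odd_primes =
  fixes K :: "nat set" and p :: "nat \<Rightarrow> nat" and n :: nat
  assumes finite_K: "finite K" and K_nonempty: "K \<noteq> {}"
    and prime_p: "\<And>i. i \<in> K \<Longrightarrow> prime (p i)" and odd_p: "\<And>i. i \<in> K \<Longrightarrow> odd (p i)"
    and inj_p: "inj_on p K" and n_def: "n = (\<Prod>i\<in>K. p i)"
begin

lemma p_gt_2: "i \<in> K \<Longrightarrow> p i > 2"
  using prime_p [of i] odd_p [of i] prime_ge_2_nat [of "p i"] by (cases "p i = 2") auto

lemma p_dvd_n: "i \<in> K \<Longrightarrow> p i dvd n"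
  unfolding n_def using finite_K by (rule dvd_prodI)

lemma n_gt_1: "n > 1"
proof -
  obtain i where i: "i \<in> K" using K_nonempty by blast
  have "p j > 0" if "j \<in> K" for j using p_gt_2 [OF that] by simp
  then have "n > 0" unfolding n_def by (simp add: prod_pos)
  then have "p i \<le> n" using p_dvd_n [OF i] by (simp add: dvd_imp_le)
  then show ?thesis using p_gt_2 [OF i] by simp
qed

lemma coprime_p: "i \<in> K \<Longrightarrow> j \<in> K \<Longrightarrow> i \<noteq> j \<Longrightarrow> coprime (p i) (p j)"
  by (rule primes_coprime) (use prime_p inj_onD [OF inj_p, of i j] in auto)

lemma prime_dvd_n_iff: "prime q \<Longrightarrow> q dvd n \<longleftrightarrow> (\<exists>i\<in>K. q = p i)"
proof
  assume q: "prime q" "q dvd n"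
  then obtain i where "i \<in> K" "q dvd p i"
    unfolding n_def using prime_dvd_prod_iff [OF finite_K q(1)] by blast
  then show "\<exists>i\<in>K. q = p i" using q(1) prime_p primes_dvd_imp_eq by blast
qed (use p_dvd_n in blast)

lemma cong_n_iff: "[x = y] (mod n) \<longleftrightarrow> (\<forall>i\<in>K. [x = y] (mod p i))"
proof
  assume "[x = y] (mod n)"
  then show "\<forall>i\<in>K. [x = y] (mod p i)" using p_dvd_n cong_dvd_modulus_nat by blast
next
  assume "\<forall>i\<in>K. [x = y] (mod p i)"
  then show "[x = y] (mod n)"
    unfolding n_def using coprime_p by (intro coprime_cong_prod_nat) auto
qed

lemma n_dvd_iff: "int n dvd z \<longleftrightarrow> (\<forall>i\<in>K. int (p i) dvd z)"
  using cong_n_iff [of "nat \<bar>z\<bar>" 0] by (simp only: cong_0_iff dvd_nat_abs_iff)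

lemma coprime_n_iff: "coprime u n \<longleftrightarrow> (\<forall>i\<in>K. coprime u (p i))"
proof
  show "\<forall>i\<in>K. coprime u (p i)" if "coprime u n"
    using coprime_divisors [OF dvd_refl p_dvd_n that] by blast
  show "coprime u n" if "\<forall>i\<in>K. coprime u (p i)"
    unfolding n_def by (rule prod_coprime_right) (use that in blast)
qed

text \<open>Chinese remainder theorem: the residues determine \<open>x\<close> below
  \<open>n\<close>, and surjectivity follows by counting, since both sides have \<open>n\<close>
  elements.\<close>

lemma bij_betw_residues:
  "bij_betw (\<lambda>x. \<lambda>i\<in>K. x mod p i) {..<n} (\<Pi>\<^sub>E i\<in>K. {..<p i})"
proof -
  let ?f = "\<lambda>x. \<lambda>i\<in>K. x mod p i"
  have inj: "inj_on ?f {..<n}"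
  proof (rule inj_onI)
    fix x y assume xy: "x \<in> {..<n}" "y \<in> {..<n}" "?f x = ?f y"
    have "[x = y] (mod p i)" if "i \<in> K" for i
      using fun_cong [OF xy(3), of i] that by (simp add: cong_def)
    then have "[x = y] (mod n)" by (simp add: cong_n_iff)
    then show "x = y" using xy by (simp add: cong_def)
  qed
  moreover have "?f ` {..<n} = (\<Pi>\<^sub>E i\<in>K. {..<p i})"
  proof (rule card_subset_eq)
    show "finite (\<Pi>\<^sub>E i\<in>K. {..<p i})" using finite_K by (intro finite_PiE) auto
    show "?f ` {..<n} \<subseteq> (\<Pi>\<^sub>E i\<in>K. {..<p i})" using p_gt_2 by (fastforce simp: PiE_iff)
    show "card (?f ` {..<n}) = card (\<Pi>\<^sub>E i\<in>K. {..<p i})"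
      using finite_K by (simp add: card_image [OF inj] card_PiE flip: n_def)
  qed
  ultimately show ?thesis by (simp add: bij_betw_def)
qed

lemma card_residues:
  assumes "\<And>i. i \<in> K \<Longrightarrow> S i \<subseteq> {..<p i}"
  shows "card {x\<in>{..<n}. \<forall>i\<in>K. x mod p i \<in> S i} = (\<Prod>i\<in>K. card (S i))"
proof -
  let ?f = "\<lambda>x. \<lambda>i\<in>K. x mod p i" and ?X = "{x\<in>{..<n}. \<forall>i\<in>K. x mod p i \<in> S i}"
  have "?f ` ?X = (\<Pi>\<^sub>E i\<in>K. S i)"
  proof (intro equalityI subsetI)
    fix g assume g: "g \<in> (\<Pi>\<^sub>E i\<in>K. S i)"
    then have "g \<in> (\<Pi>\<^sub>E i\<in>K. {..<p i})" using assms by (auto simp: PiE_iff)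
    then have "g \<in> ?f ` {..<n}" using bij_betw_imp_surj_on [OF bij_betw_residues] by simp
    then obtain x where x: "x \<in> {..<n}" "g = ?f x" by blast
    then have "\<forall>i\<in>K. x mod p i \<in> S i" using g by (auto simp: PiE_iff)
    with x show "g \<in> ?f ` ?X" by blast
  qed (auto simp: PiE_iff)
  moreover have "inj_on ?f ?X"
    using bij_betw_residues by (rule inj_on_subset [OF bij_betw_imp_inj_on]) auto
  ultimately have "card ?X = card (\<Pi>\<^sub>E i\<in>K. S i)" using card_image by fastforce
  then show ?thesis using finite_K by (simp add: card_PiE)
qed

text \<open>For \<open>u\<close> prime to \<open>n\<close>, the entry at \<open>i\<close> is the
  index of the subgroup generated by \<open>u\<close> in the unit group modulo \<open>p i\<close>.
  It is undefined off \<open>K\<close>, so that the tuple lies in the extensional product over which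
  \<open>d\<close> runs.\<close>

definition index :: "nat \<Rightarrow> nat \<Rightarrow> nat" where
  "index u = (\<lambda>i\<in>K. (p i - 1) div ord (p i) u)"

text \<open>For \<open>J \<subseteq> K\<close> these are the elements whose additive order is the
  product of the \<open>p i\<close> with \<open>i\<close> in \<open>J\<close>; the empty
  \<open>J\<close> gives only 0.\<close>

definition stratum :: "nat set \<Rightarrow> int set" where
  "stratum J = {x \<in> {0..<int n}. \<forall>i\<in>K. int (p i) dvd x \<longleftrightarrow> i \<notin> J}"

lemma card_stratum:
  assumes "J \<subseteq> K"
  shows "card (stratum J) = P_J p J"
proof -
  \<comment> \<open>The residue is nonzero at the primes in \<open>J\<close> and 0 at the others,
    which therefore contribute a factor 1.\<close>
  define S where "S i = (if i \<in> J then {1..<p i} else {0})" for i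
  have eq: "x mod p i \<in> S i \<longleftrightarrow> (p i dvd x \<longleftrightarrow> i \<notin> J)" if "i \<in> K" for i x
    using p_gt_2 [OF that] by (auto simp: S_def dvd_eq_mod_eq_0 Suc_le_eq)
  have "stratum J = int ` {x\<in>{..<n}. \<forall>i\<in>K. x mod p i \<in> S i}"
  proof (intro equalityI subsetI)
    fix x assume x: "x \<in> stratum J"
    then obtain y where "x = int y" by (auto simp: stratum_def dest: nonneg_int_cases)
    with x show "x \<in> int ` {x\<in>{..<n}. \<forall>i\<in>K. x mod p i \<in> S i}"
      by (auto simp: stratum_def eq)
  next
    fix x assume "x \<in> int ` {x\<in>{..<n}. \<forall>i\<in>K. x mod p i \<in> S i}"
    then obtain y where "x = int y" "y < n" "\<forall>i\<in>K. y mod p i \<in> S i" by blast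
    then show "x \<in> stratum J" by (simp add: stratum_def eq)
  qed
  then have "card (stratum J) = card {x\<in>{..<n}. \<forall>i\<in>K. x mod p i \<in> S i}"
    by (simp add: card_image)
  also have "\<dots> = (\<Prod>i\<in>K. card (S i))"
    by (rule card_residues) (auto simp: S_def dest!: p_gt_2)
  also have "\<dots> = (\<Prod>i\<in>J. card (S i))"
    using finite_K assms by (intro prod.mono_neutral_right) (auto simp: S_def)
  also have "\<dots> = P_J p J" by (simp add: P_J_def S_def)
  finally show ?thesis .
qed

text \<open>By the Chinese remainder theorem the orders can be prescribed independently, and the
  cyclic unit group modulo \<open>p i\<close> has \<open>totient (m i)\<close> elements of order
  \<open>m i\<close>.\<close>

lemma card_units_with_orders:
  assumes "\<And>i. i \<in> K \<Longrightarrow> m i dvd p i - 1"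
  shows "card {u \<in> totatives n. \<forall>i\<in>K. ord (p i) u = m i} = (\<Prod>i\<in>K. totient (m i))"
proof -
  define S where "S i = {x \<in> totatives (p i). ord (p i) x = m i}" for i
  have m_pos: "m i > 0" if "i \<in> K" for i
    using assms [OF that] p_gt_2 [OF that] by (auto intro!: Nat.gr0I)
  have S: "S i = {x\<in>{..<p i}. ord (p i) x = m i}" if "i \<in> K" for i
    using elements_with_ord_restrict_totatives [of "p i" "m i"] p_gt_2 [OF that] m_pos [OF that]
    by (simp add: S_def)
  have card_S: "card (S i) = totient (m i)" if "i \<in> K" for i
    using prime_card_elements_with_ord_eq_totient [of "p i" "m i"] p_gt_2 [OF that]
      prime_p [OF that] assms [OF that] by (simp add: S_def)
  have "{u \<in> totatives n. \<forall>i\<in>K. ord (p i) u = m i} = {x\<in>{..<n}. \<forall>i\<in>K. x mod p i \<in> S i}"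
  proof (rule Collect_cong)
    fix u
    \<comment> \<open>\<open>ord\<close> is positive only for coprime arguments, so positive orders
      at all primes already force \<open>u\<close> to be a unit.\<close>
    have "coprime u n" if "\<forall>i\<in>K. ord (p i) u = m i"
      unfolding coprime_n_iff using that m_pos ord_gt_0_iff by (metis coprime_commute)
    moreover have "x mod p i \<in> S i \<longleftrightarrow> ord (p i) x = m i" if "i \<in> K" for i x
      using S [OF that] p_gt_2 [OF that] by simp
    moreover have "u \<in> totatives n \<longleftrightarrow> u < n \<and> coprime u n"
      using n_gt_1 totatives_less [of u n] by (cases "u = 0") (auto simp: totatives_def)
    ultimately show "u \<in> totatives n \<and> (\<forall>i\<in>K. ord (p i) u = m i) \<longleftrightarrow>
        u \<in> {..<n} \<and> (\<forall>i\<in>K. u mod p i \<in> S i)"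
      by auto
  qed
  also have "card \<dots> = (\<Prod>i\<in>K. card (S i))"
    by (rule card_residues) (auto simp: S)
  also have "\<dots> = (\<Prod>i\<in>K. totient (m i))" by (intro prod.cong refl card_S)
  finally show ?thesis .
qed

end

section \<open>Orbits of the group generated by a unit and -1\<close>

locale odd_primes_unit = odd_primes +
  fixes u :: nat
  assumes coprime_u: "coprime u n"
begin

text \<open>The orbit of \<open>x\<close> under the group generated by \<open>u\<close> and -1.
  Natural exponents reach all of it because \<open>u\<close> has finite order modulo
  \<open>n\<close>; the two signs are kept as separate ranges for the count in
  \<open>card_cls\<close>.\<close>

definition cls :: "int \<Rightarrow> int set" where
  "cls x = range (\<lambda>k. int u ^ k * x mod int n) \<union> range (\<lambda>k. - (int u ^ k * x) mod int n)"

lemma coprime_u_p: "i \<in> K \<Longrightarrow> coprime u (p i)"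
  using coprime_u by (simp add: coprime_n_iff)

lemma ord_dvd: "i \<in> K \<Longrightarrow> ord (p i) u dvd p i - 1"
  using order_divides_totient [of "p i" u] coprime_u_p [of i] totient_prime [OF prime_p, of i]
  by (simp add: ac_simps)

lemma
  assumes "i \<in> K"
  shows index_dvd: "index u i dvd p i - 1" and div_index: "(p i - 1) div index u i = ord (p i) u"
proof -
  obtain q where q: "p i - 1 = ord (p i) u * q" using ord_dvd [OF assms] by (rule dvdE)
  moreover have "p i - 1 > 0" using p_gt_2 [OF assms] by simp
  ultimately have pos: "ord (p i) u > 0" "q > 0" by (metis nat_0_less_mult_iff)+
  have index: "index u i = q" unfolding index_def restrict_apply q using assms pos by simp
  show "index u i dvd p i - 1" unfolding index q by (rule dvd_triv_right)
  show "(p i - 1) div index u i = ord (p i) u" unfolding index q using pos by simp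
qed

lemma p_dvd_power_mult_iff:
  assumes "i \<in> K"
  shows "int (p i) dvd int u ^ k * x \<longleftrightarrow> int (p i) dvd x"
proof -
  have "coprime (int u) (int (p i))" using coprime_u_p [OF assms] by simp
  then have "coprime (int (p i)) (int u ^ k)"
    by (simp add: ac_simps)
  then show ?thesis by (rule coprime_dvd_mult_right_iff)
qed

lemma mem_cls_iff:
  "y \<in> cls x \<longleftrightarrow> y \<in> {0..<int n} \<and> (\<exists>k. \<exists>s\<in>{1,-1}. [y = s * int u ^ k * x] (mod int n))"
proof -
  have mod_eq: "y = z mod int n \<longleftrightarrow> y \<in> {0..<int n} \<and> [y = z] (mod int n)" for z
  proof
    assume "y = z mod int n"
    then show "y \<in> {0..<int n} \<and> [y = z] (mod int n)" using n_gt_1 by (simp add: cong_def)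
  next
    assume *: "y \<in> {0..<int n} \<and> [y = z] (mod int n)"
    then have "y mod int n = y" by simp
    with * show "y = z mod int n" unfolding cong_def by (elim conjE) simp
  qed
  have bex: "(\<exists>s\<in>{1,-1}. [y = s * int u ^ k * x] (mod int n)) \<longleftrightarrow>
      [y = int u ^ k * x] (mod int n) \<or> [y = - (int u ^ k * x)] (mod int n)" for k
    by simp
  have "y \<in> cls x \<longleftrightarrow> (\<exists>k. y = int u ^ k * x mod int n \<or> y = - (int u ^ k * x) mod int n)"
    unfolding cls_def by blast
  then show ?thesis unfolding mod_eq bex by blast
qed

lemma clsE:
  assumes "y \<in> cls x"
  obtains k s where "s \<in> {1,-1}" "[y = s * int u ^ k * x] (mod int n)"
proof -
  from assms have "\<exists>k. \<exists>s\<in>{1,-1}. [y = s * int u ^ k * x] (mod int n)"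
    by (simp only: mem_cls_iff)
  then show ?thesis by (elim exE bexE) (rule that)
qed

lemma cls_self: "x \<in> {0..<int n} \<Longrightarrow> x \<in> cls x"
  unfolding mem_cls_iff by (intro conjI exI [of _ 0] bexI [of _ 1]) auto

lemma cls_trans:
  assumes "y \<in> cls x" "z \<in> cls y"
  shows "z \<in> cls x"
proof -
  obtain k s where s: "s \<in> {1,-1}" "[y = s * int u ^ k * x] (mod int n)"
    using assms(1) by (rule clsE)
  obtain j t where t: "t \<in> {1,-1}" "[z = t * int u ^ j * y] (mod int n)"
    using assms(2) by (rule clsE)
  have "[z = t * int u ^ j * (s * int u ^ k * x)] (mod int n)"
    by (rule cong_trans [OF t(2) cong_scalar_left [OF s(2)]])
  then have "[z = (t * s) * int u ^ (j + k) * x] (mod int n)" by (simp add: power_add ac_simps)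
  moreover have "t * s \<in> {1,-1}" using s(1) t(1) by auto
  ultimately have "\<exists>k. \<exists>s\<in>{1,-1}. [z = s * int u ^ k * x] (mod int n)" by (intro exI bexI)
  then show ?thesis using assms(2) by (simp only: mem_cls_iff)
qed

lemma cls_sym:
  assumes "x \<in> {0..<int n}" "y \<in> cls x"
  shows "x \<in> cls y"
proof -
  obtain k s where s: "s \<in> {1,-1}" "[y = s * int u ^ k * x] (mod int n)"
    using assms(2) by (rule clsE)
  \<comment> \<open>As \<open>u ^ D\<close> is 1 modulo \<open>n\<close>, the exponent
    \<open>(D - 1) * k\<close> undoes the exponent \<open>k\<close>; the sign \<open>s\<close> is
    its own inverse.\<close>
  define D where "D = ord n u"
  have "D > 0" using coprime_u by (simp add: D_def coprime_commute)
  have "[u ^ D = 1] (mod n)" unfolding D_def by (rule ord)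
  then have "[int u ^ D = 1] (mod int n)" by (metis cong_int_iff of_nat_1 of_nat_power)
  then have "[(int u ^ D) ^ k = 1] (mod int n)" using cong_pow [of "int u ^ D" 1 "int n" k] by simp
  then have "[(int u ^ D) ^ k * x = 1 * x] (mod int n)" by (rule cong_scalar_right)
  moreover have "s * int u ^ ((D - 1) * k) * (s * int u ^ k * x) = (int u ^ D) ^ k * x"
  proof -
    have "D * k = (D - 1) * k + k" using \<open>D > 0\<close> by (cases D) auto
    then have "(int u ^ D) ^ k = int u ^ ((D - 1) * k) * int u ^ k"
      by (metis power_add power_mult)
    then show ?thesis using s(1) by auto
  qed
  moreover have "[s * int u ^ ((D - 1) * k) * y = s * int u ^ ((D - 1) * k) * (s * int u ^ k * x)] (mod int n)"
    using s(2) by (rule cong_scalar_left)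
  ultimately have "[s * int u ^ ((D - 1) * k) * y = x] (mod int n)"
    by (metis cong_trans mult_1)
  then have "\<exists>k. \<exists>s\<in>{1,-1}. [x = s * int u ^ k * y] (mod int n)"
    using s(1) by (intro exI bexI) (rule cong_sym)
  then show ?thesis using assms(1) by (simp only: mem_cls_iff)
qed

lemma cls_eq:
  assumes "x \<in> {0..<int n}" "y \<in> cls x"
  shows "cls y = cls x"
proof (intro equalityI subsetI)
  show "z \<in> cls x" if "z \<in> cls y" for z using assms(2) that by (rule cls_trans)
  show "z \<in> cls y" if "z \<in> cls x" for z using cls_sym [OF assms] that by (rule cls_trans)
qed

text \<open>Multiplication by \<open>u\<close> or by -1 is invertible modulo every
  \<open>p i\<close>, so an orbit never leaves its stratum.\<close>

lemma p_dvd_cls_iff: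
  assumes "i \<in> K" "y \<in> cls x"
  shows "int (p i) dvd y \<longleftrightarrow> int (p i) dvd x"
proof -
  obtain k s where s: "s \<in> {1,-1}" "[y = s * int u ^ k * x] (mod int n)"
    using assms(2) by (rule clsE)
  have "int (p i) dvd int n" using p_dvd_n [OF assms(1)] by simp
  then have "[y = s * int u ^ k * x] (mod int (p i))" using s(2) cong_dvd_modulus by blast
  then have "int (p i) dvd y \<longleftrightarrow> int (p i) dvd s * int u ^ k * x" by (rule cong_dvd_iff)
  then show ?thesis using s(1) p_dvd_power_mult_iff [OF assms(1)] by auto
qed

lemma cls_subset_stratum: "x \<in> stratum J \<Longrightarrow> cls x \<subseteq> stratum J"
proof
  fix y assume "x \<in> stratum J" "y \<in> cls x"
  then show "y \<in> stratum J" using p_dvd_cls_iff [OF _ \<open>y \<in> cls x\<close>] by (simp add: stratum_def mem_cls_iff)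
qed

text \<open>A finite set mapped into itself by an injective map is mapped onto itself, so closure
  gives the two equalities. Conversely, closure under the two generators is iterated.\<close>

lemma saturated_iff:
  assumes "\<Omega> \<subseteq> {0..<int n}"
  shows "(\<forall>x\<in>\<Omega>. cls x \<subseteq> \<Omega>) \<longleftrightarrow>
    (\<lambda>x. int u * x mod int n) ` \<Omega> = \<Omega> \<and> (\<lambda>x. - x mod int n) ` \<Omega> = \<Omega>"
proof
  assume sat: "\<forall>x\<in>\<Omega>. cls x \<subseteq> \<Omega>"
  have fin: "finite \<Omega>" using assms by (rule finite_subset) simp
  have "int u ^ 1 * x mod int n \<in> cls x" "- (int u ^ 0 * x) mod int n \<in> cls x" for x
    unfolding cls_def by blast+
  then have mem: "int u * x mod int n \<in> \<Omega>" "- x mod int n \<in> \<Omega>" if "x \<in> \<Omega>" for x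
    using sat that by auto
  have eq: "x = y" if "x \<in> \<Omega>" "y \<in> \<Omega>" "[x = y] (mod int n)" for x y
  proof -
    have "x \<in> {0..<int n}" "y \<in> {0..<int n}" using that assms by blast+
    then show ?thesis using that(3) by (simp add: cong_def)
  qed
  have "inj_on (\<lambda>x. int u * x mod int n) \<Omega>"
  proof (rule inj_onI)
    fix x y assume xy: "x \<in> \<Omega>" "y \<in> \<Omega>" "int u * x mod int n = int u * y mod int n"
    then have "[int u * x = int u * y] (mod int n)" by (simp add: cong_def)
    then have "[x = y] (mod int n)" using cong_mult_lcancel [of "int u" "int n"] coprime_u by simp
    then show "x = y" by (rule eq [OF xy(1,2)])
  qed
  moreover have "inj_on (\<lambda>x. - x mod int n) \<Omega>"
  proof (rule inj_onI)
    fix x y assume xy: "x \<in> \<Omega>" "y \<in> \<Omega>" "- x mod int n = - y mod int n"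
    then have "[x = y] (mod int n)" by (simp only: cong_def [symmetric] cong_minus_minus_iff)
    then show "x = y" by (rule eq [OF xy(1,2)])
  qed
  ultimately show "(\<lambda>x. int u * x mod int n) ` \<Omega> = \<Omega> \<and> (\<lambda>x. - x mod int n) ` \<Omega> = \<Omega>"
    using mem by (intro conjI endo_inj_surj [OF fin] image_subsetI)
next
  assume inv: "(\<lambda>x. int u * x mod int n) ` \<Omega> = \<Omega> \<and> (\<lambda>x. - x mod int n) ` \<Omega> = \<Omega>"
  then have mem: "int u * x mod int n \<in> \<Omega>" "- x mod int n \<in> \<Omega>" if "x \<in> \<Omega>" for x
    using that imageI [of x \<Omega> "\<lambda>x. int u * x mod int n"] imageI [of x \<Omega> "\<lambda>x. - x mod int n"] by simp_all
  show "\<forall>x\<in>\<Omega>. cls x \<subseteq> \<Omega>"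
  proof
    fix x assume x: "x \<in> \<Omega>"
    have pos: "int u ^ k * x mod int n \<in> \<Omega>" for k
    proof (induction k)
      case 0
      have "x \<in> {0..<int n}" using x assms by blast
      then show ?case using x by simp
    next
      case (Suc k)
      then show ?case using mem(1) [OF Suc] by (simp add: mod_mult_right_eq mult.assoc)
    qed
    have "- (int u ^ k * x) mod int n \<in> \<Omega>" for k
      using mem(2) [OF pos [of k]] by (simp only: mod_minus_eq)
    with pos show "cls x \<subseteq> \<Omega>" unfolding cls_def by (intro Un_least image_subsetI)
  qed
qed


section \<open>Sizes of orbits\<close>

text \<open>\<open>power_cong_minus_one_iff\<close> translates one prime at a time with the same
  \<open>c\<close>. What remains is that \<open>alpha_J\<close> allows a negative \<open>c\<close>,
  whereas an exponent is natural.\<close>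

lemma minus_one_power_iff:
  assumes "J \<subseteq> K"
  shows "(\<exists>c::nat. \<forall>i\<in>J. [int u ^ c = -1] (mod int (p i))) \<longleftrightarrow>
    (\<exists>c::int. \<forall>i\<in>J. [c * int (index u i) = int ((p i - 1) div 2)] (mod int (p i - 1)))"
proof -
  have iff: "[int u ^ c = -1] (mod int (p i)) \<longleftrightarrow>
      [int c * int (index u i) = int ((p i - 1) div 2)] (mod int (p i - 1))" if "i \<in> J" for c i
  proof -
    have i: "i \<in> K" using that assms by blast
    have "coprime (p i) u" using coprime_u_p [OF i] by (simp only: coprime_commute)
    then show ?thesis
      using power_cong_minus_one_iff [OF prime_p [OF i] odd_p [OF i]] i by (simp only: index_def restrict_apply if_True)
  qed
  show ?thesis
  proof
    assume "\<exists>c::nat. \<forall>i\<in>J. [int u ^ c = -1] (mod int (p i))"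
    then obtain c :: nat where "\<forall>i\<in>J. [int u ^ c = -1] (mod int (p i))" ..
    then have "\<forall>i\<in>J. [int c * int (index u i) = int ((p i - 1) div 2)] (mod int (p i - 1))"
      by (intro ballI iff [THEN iffD1]) (assumption | erule (1) bspec)+
    then show "\<exists>c::int. \<forall>i\<in>J. [c * int (index u i) = int ((p i - 1) div 2)] (mod int (p i - 1))" ..
  next
    assume "\<exists>c::int. \<forall>i\<in>J. [c * int (index u i) = int ((p i - 1) div 2)] (mod int (p i - 1))"
    then obtain c :: int where c: "\<And>i. i \<in> J \<Longrightarrow>
        [c * int (index u i) = int ((p i - 1) div 2)] (mod int (p i - 1))" by blast
    have pos: "P_J p J > 0"
      unfolding P_J_def using assms p_gt_2 by (intro prod_pos) fastforce
    \<comment> \<open>\<open>P_J p J\<close> is a common multiple of all \<open>p i - 1\<close>, so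
      reducing modulo it preserves every congruence and makes the exponent natural.\<close>
    define c' where "c' = nat (c mod int (P_J p J))"
    have "int c' = c mod int (P_J p J)" using pos by (simp add: c'_def)
    then have cc: "[int c' = c] (mod int (P_J p J))" by (simp add: cong_def)
    have "[int u ^ c' = -1] (mod int (p i))" if "i \<in> J" for i
    proof -
      have "p i - 1 dvd P_J p J"
        unfolding P_J_def using finite_subset [OF assms finite_K] that by (rule dvd_prodI)
      then have "[int c' = c] (mod int (p i - 1))"
        using cc cong_dvd_modulus of_nat_dvd_iff by blast
      then have "[int c' * int (index u i) = c * int (index u i)] (mod int (p i - 1))"
        by (rule cong_scalar_right)
      from cong_trans [OF this c [OF that]] show ?thesis by (simp only: iff [OF that])
    qed
    then show "\<exists>c::nat. \<forall>i\<in>J. [int u ^ c = -1] (mod int (p i))" by blast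
  qed
qed

text \<open>The index is the cofactor of the order, so \<open>L_J\<close> is the order of
  \<open>u\<close> modulo the product of the \<open>p i\<close> with \<open>i\<close> in
  \<open>J\<close>.\<close>

lemma L_J_index:
  assumes "J \<subseteq> K"
  shows "L_J p (index u) J = Lcm ((\<lambda>i. ord (p i) u) ` J)"
proof -
  have "(\<lambda>i. (p i - 1) div index u i) ` J = (\<lambda>i. ord (p i) u) ` J"
    using assms by (intro image_cong refl div_index) blast
  then show ?thesis by (simp only: L_J_def)
qed

lemma L_J_pos:
  assumes "J \<subseteq> K"
  shows "L_J p (index u) J > 0"
proof -
  have "ord (p i) u > 0" if "i \<in> J" for i
    using coprime_u_p [of i] that assms by (simp add: subset_iff ac_simps)
  then have "0 \<notin> (\<lambda>i. ord (p i) u) ` J" by (metis (no_types, lifting) imageE less_irrefl)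
  moreover have "finite ((\<lambda>i. ord (p i) u) ` J)" using finite_subset [OF assms finite_K] by simp
  ultimately show ?thesis using Lcm_0_iff by (simp add: L_J_index [OF assms] neq0_conv [symmetric] del: neq0_conv)
qed

lemma finite_stratum: "finite (stratum J)"
  unfolding stratum_def by (rule finite_subset [of _ "{0..<int n}"]) auto

lemma alpha_J_pos: "J \<subseteq> K \<Longrightarrow> alpha_J p (index u) J > 0"
  using L_J_pos [of J] by (simp add: alpha_J_def)

text \<open>The ranges for the two signs have \<open>L_J\<close> elements each. They coincide if -1
  is a power of \<open>u\<close> modulo all primes in \<open>J\<close> and are disjoint otherwise,
  which is the case distinction in \<open>alpha_J\<close>.\<close>

lemma card_cls:
  assumes J: "J \<subseteq> K" and x: "x \<in> stratum J"
  shows "card (cls x) = alpha_J p (index u) J"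
proof -
  define L where "L = L_J p (index u) J"
  define f where "f k = int u ^ k * x mod int n" for k
  define g where "g k = - (int u ^ k * x) mod int n" for k
  have cls: "cls x = range f \<union> range g" unfolding cls_def f_def g_def ..
  \<comment> \<open>The primes outside \<open>J\<close> divide \<open>x\<close> and those inside do
    not, so only the latter constrain \<open>z\<close>.\<close>
  have n_dvd: "int n dvd z * x \<longleftrightarrow> (\<forall>i\<in>J. int (p i) dvd z)" for z
  proof -
    have "int (p i) dvd z * x \<longleftrightarrow> (i \<in> J \<longrightarrow> int (p i) dvd z)" if "i \<in> K" for i
      using x that prime_p [OF that] by (auto simp: stratum_def prime_dvd_mult_iff)
    then show ?thesis using J by (auto simp: n_dvd_iff)
  qed
  have cong: "(\<forall>i\<in>J. int (p i) dvd int u ^ j - int u ^ k) \<longleftrightarrow> [j = k] (mod L)" for j k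
  proof -
    have "int (p i) dvd int u ^ j - int u ^ k \<longleftrightarrow> [j = k] (mod ord (p i) u)" if "i \<in> J" for i
    proof -
      have "coprime (p i) u" using coprime_u_p J that by (metis coprime_commute subsetD)
      then have "[u ^ j = u ^ k] (mod p i) \<longleftrightarrow> [j = k] (mod ord (p i) u)"
        by (rule order_divides_expdiff)
      then show ?thesis by (metis cong_iff_dvd_diff cong_int_iff of_nat_power)
    qed
    then show ?thesis by (simp add: L_def L_J_index [OF J] cong_Lcm_iff)
  qed
  have "f j = f k \<longleftrightarrow> [j = k] (mod L)" for j k
    unfolding f_def mod_eq_dvd_iff left_diff_distrib [symmetric] n_dvd cong ..
  then have card_f: "card (range f) = L" using L_J_pos [OF J] by (simp add: card_range_periodic L_def)
  have "g j = g k \<longleftrightarrow> [k = j] (mod L)" for j k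
  proof -
    have "g j = g k \<longleftrightarrow> int n dvd (int u ^ k - int u ^ j) * x"
      unfolding g_def mod_eq_dvd_iff by (simp add: algebra_simps)
    then show ?thesis unfolding n_dvd cong .
  qed
  then have card_g: "card (range g) = L"
    using L_J_pos [OF J] by (intro card_range_periodic) (simp_all add: L_def cong_sym_eq)
  have fg: "f j = g k \<longleftrightarrow> (\<forall>i\<in>J. int (p i) dvd int u ^ j + int u ^ k)" for j k
  proof -
    have "f j = g k \<longleftrightarrow> int n dvd (int u ^ j + int u ^ k) * x"
      unfolding f_def g_def mod_eq_dvd_iff by (simp add: algebra_simps)
    then show ?thesis unfolding n_dvd .
  qed
  show ?thesis
  proof (cases "\<exists>c::nat. \<forall>i\<in>J. [int u ^ c = -1] (mod int (p i))")
    case True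
    then obtain c :: nat where "\<forall>i\<in>J. [int u ^ c = -1] (mod int (p i))" ..
    then have c: "int (p i) dvd int u ^ c + 1" if "i \<in> J" for i
      using that by (simp add: cong_iff_dvd_diff)
    \<comment> \<open>Shifting the exponent by \<open>c\<close> changes the sign, so each range is
      contained in the other.\<close>
    have dvd: "int (p i) dvd int u ^ (k + c) + int u ^ k" if "i \<in> J" for i k
    proof -
      have "int (p i) dvd int u ^ k * (int u ^ c + 1)" using c [OF that] by (rule dvd_mult)
      then show ?thesis by (simp add: power_add distrib_left)
    qed
    then have "f (k + c) = g k" for k unfolding fg by blast
    moreover have "f k = g (k + c)" for k unfolding fg using dvd [of _ k] by (simp add: ac_simps)
    ultimately have "range f = range g" by (metis (no_types, lifting) image_subset_iff rangeI subset_antisym)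
    then have "card (cls x) = L" by (simp add: cls card_g)
    then show ?thesis using True unfolding minus_one_power_iff [OF J] by (simp add: alpha_J_def L_def)
  next
    case False
    have "f j \<noteq> g k" for j k
    proof
      assume "f j = g k"
      \<comment> \<open>A coincidence would make \<open>u\<close> to the power \<open>j - k\<close>
        equal to -1 at all primes in \<open>J\<close>; \<open>(D - 1) * k + j\<close> is a natural
        representative of \<open>j - k\<close> modulo the order \<open>D\<close>.\<close>
      define D where "D = ord n u"
      have "D > 0" using coprime_u by (simp add: D_def ac_simps)
      have "[u ^ D = 1] (mod n)" unfolding D_def by (rule ord)
      then have "[int u ^ D = 1] (mod int n)" by (metis cong_int_iff of_nat_1 of_nat_power)
      then have uD: "[(int u ^ D) ^ k = 1] (mod int n)" using cong_pow [of "int u ^ D" 1 "int n" k] by simp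
      have "[int u ^ ((D - 1) * k + j) = -1] (mod int (p i))" if "i \<in> J" for i
      proof -
        have "i \<in> K" using that J by blast
        then have "int (p i) dvd int n" using p_dvd_n by simp
        then have "int (p i) dvd (int u ^ D) ^ k - 1"
          using uD dvd_trans by (auto simp: cong_iff_dvd_diff)
        moreover have "int (p i) dvd int u ^ ((D - 1) * k) * (int u ^ j + int u ^ k)"
          using \<open>f j = g k\<close> that by (simp add: fg)
        ultimately have "int (p i) dvd int u ^ ((D - 1) * k) * (int u ^ j + int u ^ k) - ((int u ^ D) ^ k - 1)"
          by (rule dvd_diff [rotated])
        moreover have "D * k = (D - 1) * k + k" using \<open>D > 0\<close> by (cases D) auto
        then have "(int u ^ D) ^ k = int u ^ ((D - 1) * k) * int u ^ k"
          by (metis power_add power_mult)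
        ultimately have "int (p i) dvd int u ^ ((D - 1) * k + j) + 1"
          by (simp add: power_add distrib_left)
        then show ?thesis by (simp add: cong_iff_dvd_diff)
      qed
      with False show False by blast
    qed
    then have "range f \<inter> range g = {}" by blast
    moreover have "finite (range f)" "finite (range g)"
      using card_f card_g L_J_pos [OF J] by (auto intro: card_ge_0_finite simp: L_def)
    ultimately have "card (cls x) = 2 * L" unfolding cls by (simp add: card_Un_disjoint card_f card_g)
    then show ?thesis using False unfolding minus_one_power_iff [OF J]
      by (simp only: alpha_J_def L_def if_False)
  qed
qed

section \<open>Generating functions of the sets fixed by one unit\<close>

text \<open>The nonzero common multiples split into the strata with nonempty
  \<open>J \<subseteq> K - I\<close>. Each stratum is a union of orbits of equal size, and so
  contributes the power \<open>f_J\<close>.\<close>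

lemma sum_saturated_multiples:
  assumes "I \<subseteq> K"
  shows "(\<Sum>\<Omega> | \<Omega> \<subseteq> {x \<in> {1..<int n}. \<forall>i\<in>I. int (p i) dvd x} \<and> (\<forall>x\<in>\<Omega>. cls x \<subseteq> \<Omega>).
      Polynomial.monom 1 (card \<Omega>)) = (\<Prod>J\<in>{J. J \<subseteq> K - I \<and> J \<noteq> {}}. f_J p (index u) J)"
proof -
  define X where "X = {x \<in> {1..<int n}. \<forall>i\<in>I. int (p i) dvd x}"
  define \<J> where "\<J> = {J. J \<subseteq> K - I \<and> J \<noteq> {}}"
  have finJ: "finite \<J>" unfolding \<J>_def using finite_K by simp
  have X: "X = (\<Union>J\<in>\<J>. stratum J)"
  proof (intro equalityI subsetI)
    fix x assume x: "x \<in> X"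
    define J where "J = {i\<in>K. \<not> int (p i) dvd x}"
    \<comment> \<open>Since \<open>x\<close> lies strictly between 0 and \<open>n\<close>, some
      prime does not divide it.\<close>
    have "\<not> int n dvd x" using x by (auto simp: X_def dest: zdvd_imp_le)
    then have "J \<noteq> {}" by (auto simp: J_def n_dvd_iff)
    then have "J \<in> \<J>" using x by (auto simp: J_def \<J>_def X_def)
    moreover have "x \<in> stratum J" using x by (auto simp: stratum_def J_def X_def)
    ultimately show "x \<in> (\<Union>J\<in>\<J>. stratum J)" by blast
  next
    fix x assume "x \<in> (\<Union>J\<in>\<J>. stratum J)"
    then obtain J where J: "J \<subseteq> K - I" "J \<noteq> {}" "x \<in> stratum J" by (auto simp: \<J>_def)
    then obtain j where "j \<in> J" by blast
    with J have "\<not> int (p j) dvd x" by (auto simp: stratum_def)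
    then have "x \<noteq> 0" by auto
    moreover have "int (p i) dvd x" if "i \<in> I" for i
      using J that assms by (auto simp: stratum_def)
    ultimately show "x \<in> X" using J(3) by (auto simp: X_def stratum_def)
  qed
  have sub: "cls x \<subseteq> X" if "x \<in> X" for x
    using that cls_subset_stratum unfolding X by blast
  have carr: "x \<in> {0..<int n}" if "x \<in> X" for x using that by (simp add: X_def)
  have finX: "finite X" unfolding X_def by (rule finite_subset [of _ "{1..<int n}"]) auto
  have stratum_eq: "J = J'" if "z \<in> stratum J" "z \<in> stratum J'" "J \<in> \<J>" "J' \<in> \<J>" for z J J'
  proof -
    have "i \<in> J \<longleftrightarrow> i \<in> J'" if "i \<in> K" for i
      using \<open>z \<in> stratum J\<close> \<open>z \<in> stratum J'\<close> that by (auto simp: stratum_def)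
    then show ?thesis using that(3,4) by (auto simp: \<J>_def)
  qed
  have "(\<Sum>\<Omega> | \<Omega> \<subseteq> X \<and> (\<forall>x\<in>\<Omega>. cls x \<subseteq> \<Omega>). Polynomial.monom (1::rat) (card \<Omega>))
      = (\<Prod>C\<in>cls ` X. 1 + Polynomial.monom 1 (card C))"
    by (rule sum_monom_saturated [OF finX cls_self [OF carr] sub cls_eq [OF carr]])
  also have "cls ` X = (\<Union>J\<in>\<J>. cls ` stratum J)" by (simp only: X image_UN)
  also have "(\<Prod>C\<in>(\<Union>J\<in>\<J>. cls ` stratum J). 1 + Polynomial.monom (1::rat) (card C))
      = (\<Prod>J\<in>\<J>. \<Prod>C\<in>cls ` stratum J. 1 + Polynomial.monom 1 (card C))"
  \<comment> \<open>An orbit contains its base point and stays in one stratum, which determines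
    \<open>J\<close>; hence distinct strata share no orbit.\<close>
  proof (rule prod.UNION_disjoint [OF finJ])
    show "\<forall>J\<in>\<J>. finite (cls ` stratum J)" by (simp add: finite_stratum)
    show "\<forall>J\<in>\<J>. \<forall>J'\<in>\<J>. J \<noteq> J' \<longrightarrow> cls ` stratum J \<inter> cls ` stratum J' = {}"
    proof (intro ballI impI, rule ccontr)
      fix J J' assume J: "J \<in> \<J>" "J' \<in> \<J>" "J \<noteq> J'" and "cls ` stratum J \<inter> cls ` stratum J' \<noteq> {}"
      then obtain x y where xy: "x \<in> stratum J" "y \<in> stratum J'" "cls x = cls y" by blast
      have "x \<in> cls x" using xy(1) by (intro cls_self) (simp add: stratum_def)
      then have "x \<in> stratum J'" using cls_subset_stratum [OF xy(2)] xy(3) by blast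
      with J xy(1) show False using stratum_eq by blast
    qed
  qed
  also have "\<dots> = (\<Prod>J\<in>\<J>. f_J p (index u) J)"
  proof (rule prod.cong [OF refl])
    fix J assume "J \<in> \<J>"
    then have J: "J \<subseteq> K" by (auto simp: \<J>_def)
    have car: "x \<in> {0..<int n}" if "x \<in> stratum J" for x using that by (simp add: stratum_def)
    have "card (cls ` stratum J) = card (stratum J) div alpha_J p (index u) J"
      by (rule card_classes_uniform [OF finite_stratum cls_self [OF car] cls_subset_stratum
            cls_eq [OF car] card_cls [OF J] alpha_J_pos [OF J]])
    then have card: "card (cls ` stratum J) = P_J p J div alpha_J p (index u) J"
      by (simp only: card_stratum [OF J])
    have "(\<Prod>C\<in>cls ` stratum J. 1 + Polynomial.monom (1::rat) (card C))
        = (\<Prod>C\<in>cls ` stratum J. 1 + Polynomial.monom 1 (alpha_J p (index u) J))"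
      by (rule prod.cong [OF refl]) (auto simp: card_cls [OF J])
    then show "(\<Prod>C\<in>cls ` stratum J. 1 + Polynomial.monom (1::rat) (card C)) = f_J p (index u) J"
      by (simp only: prod_constant card f_J_def)
  qed
  finally show ?thesis unfolding X_def \<J>_def .
qed

text \<open>The right side has the shape for \<open>sum_inclusion_exclusion\<close>: a base family,
  and for each prime a forbidden property, namely containment in a maximal subgroup. The empty set
  has all these properties.\<close>

lemma cayley_sets_invariant_iff:
  "\<Omega> \<in> cayley_sets (integer_mod_group n) \<and> (\<lambda>x\<in>{0..<int n}. int u * x mod int n) ` \<Omega> = \<Omega> \<longleftrightarrow>
    (\<Omega> \<subseteq> {1..<int n} \<and> (\<forall>x\<in>\<Omega>. cls x \<subseteq> \<Omega>)) \<and> (\<forall>i\<in>K. \<not> (\<forall>x\<in>\<Omega>. int (p i) dvd x))"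
proof (cases "\<Omega> \<subseteq> {1..<int n}")
  case True
  then have sub: "\<Omega> \<subseteq> {0..<int n}" by force
  have carr: "carrier (integer_mod_group n) = {0..<int n}"
    using n_gt_1 by (simp add: carrier_integer_mod_group)
  have inv: "(\<lambda>x. inv\<^bsub>integer_mod_group n\<^esub> x) ` \<Omega> = (\<lambda>x. - x mod int n) ` \<Omega>"
    using sub by (intro image_cong refl inv_integer_mod_group) (auto simp: carr)
  have mult: "(\<lambda>x\<in>{0..<int n}. int u * x mod int n) ` \<Omega> = (\<lambda>x. int u * x mod int n) ` \<Omega>"
    using sub by (intro image_cong refl) auto
  have gen: "generate (integer_mod_group n) \<Omega> = {0..<int n} \<longleftrightarrow>
      (\<forall>i\<in>K. \<not> (\<forall>x\<in>\<Omega>. int (p i) dvd x))"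
    unfolding generate_integer_mod_group_iff [OF n_gt_1 sub]
  proof (intro iffI ballI allI impI)
    fix i assume "\<forall>q. prime q \<and> q dvd n \<longrightarrow> (\<exists>x\<in>\<Omega>. \<not> int q dvd x)" "i \<in> K"
    then show "\<not> (\<forall>x\<in>\<Omega>. int (p i) dvd x)" using prime_p [of i] p_dvd_n [of i] by simp
  next
    fix q assume *: "\<forall>i\<in>K. \<not> (\<forall>x\<in>\<Omega>. int (p i) dvd x)" and q: "prime q \<and> q dvd n"
    then obtain i where "i \<in> K" "q = p i" using prime_dvd_n_iff [of q] by blast
    with * show "\<exists>x\<in>\<Omega>. \<not> int q dvd x" by simp
  qed
  have zero: "0 \<notin> \<Omega>" using True by force
  show ?thesis
    by (simp only: cayley_sets_def mem_Collect_eq saturated_iff [OF sub] carr one_integer_mod_group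
        inv mult gen zero sub True simp_thms conj_ac)
next
  \<comment> \<open>Such a set leaves the carrier or contains the identity 0, so both sides are
    false.\<close>
  case False
  have "\<Omega> \<notin> cayley_sets (integer_mod_group n)"
  proof
    assume "\<Omega> \<in> cayley_sets (integer_mod_group n)"
    then have "\<Omega> \<subseteq> {0..<int n}" "0 \<notin> \<Omega>"
      using n_gt_1 by (simp_all add: cayley_sets_def carrier_integer_mod_group)
    then have "x \<in> {1..<int n}" if "x \<in> \<Omega>" for x
      using that subsetD [of \<Omega> "{0..<int n}" x] by (cases "x = 0") auto
    with False show False by blast
  qed
  with False show ?thesis by simp
qed

lemma sum_cayley_sets_invariant:
  "(\<Sum>\<Omega> | \<Omega> \<in> cayley_sets (integer_mod_group n) \<and> (\<lambda>x\<in>{0..<int n}. int u * x mod int n) ` \<Omega> = \<Omega>.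
      Polynomial.monom 1 (card \<Omega>))
    = (\<Sum>I\<in>Pow K. (-1) ^ card I * (\<Prod>J\<in>{J. J \<subseteq> K - I \<and> J \<noteq> {}}. f_J p (index u) J))"
proof -
  let ?S = "{\<Omega>. \<Omega> \<subseteq> {1..<int n} \<and> (\<forall>x\<in>\<Omega>. cls x \<subseteq> \<Omega>)}"
  have fin: "finite ?S" by (rule finite_subset [of _ "Pow {1..<int n}"]) auto
  have "{\<Omega>. \<Omega> \<in> cayley_sets (integer_mod_group n) \<and> (\<lambda>x\<in>{0..<int n}. int u * x mod int n) ` \<Omega> = \<Omega>}
      = {\<Omega>. \<Omega> \<in> ?S \<and> (\<forall>i\<in>K. \<not> (\<forall>x\<in>\<Omega>. int (p i) dvd x))}"
    by (simp only: cayley_sets_invariant_iff mem_Collect_eq)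
  then have "(\<Sum>\<Omega> | \<Omega> \<in> cayley_sets (integer_mod_group n) \<and> (\<lambda>x\<in>{0..<int n}. int u * x mod int n) ` \<Omega> = \<Omega>.
      Polynomial.monom (1::rat) (card \<Omega>))
    = (\<Sum>\<Omega> | \<Omega> \<in> ?S \<and> (\<forall>i\<in>K. \<not> (\<forall>x\<in>\<Omega>. int (p i) dvd x)). Polynomial.monom 1 (card \<Omega>))"
    by (rule arg_cong)
  also have "\<dots> = (\<Sum>I\<in>Pow K. (-1) ^ card I *
      (\<Sum>\<Omega> | \<Omega> \<in> ?S \<and> (\<forall>i\<in>I. \<forall>x\<in>\<Omega>. int (p i) dvd x). Polynomial.monom 1 (card \<Omega>)))"
    by (rule sum_inclusion_exclusion [OF fin finite_K])
  also have "\<dots> = (\<Sum>I\<in>Pow K. (-1) ^ card I * (\<Prod>J\<in>{J. J \<subseteq> K - I \<and> J \<noteq> {}}. f_J p (index u) J))"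
  proof (rule sum.cong [OF refl])
    fix I assume "I \<in> Pow K"
    then have I: "I \<subseteq> K" by simp
    \<comment> \<open>Imposing the properties for all of \<open>I\<close> only shrinks the ground
      set to common multiples.\<close>
    have "{\<Omega>. \<Omega> \<in> ?S \<and> (\<forall>i\<in>I. \<forall>x\<in>\<Omega>. int (p i) dvd x)}
      = {\<Omega>. \<Omega> \<subseteq> {x \<in> {1..<int n}. \<forall>i\<in>I. int (p i) dvd x} \<and> (\<forall>x\<in>\<Omega>. cls x \<subseteq> \<Omega>)}"
      by blast
    then show "(-1) ^ card I * (\<Sum>\<Omega> | \<Omega> \<in> ?S \<and> (\<forall>i\<in>I. \<forall>x\<in>\<Omega>. int (p i) dvd x). Polynomial.monom (1::rat) (card \<Omega>))
        = (-1) ^ card I * (\<Prod>J\<in>{J. J \<subseteq> K - I \<and> J \<noteq> {}}. f_J p (index u) J)"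
      by (simp only: sum_saturated_multiples [OF I])
  qed
  finally show ?thesis .
qed

end

section \<open>Summation over units and over index tuples\<close>

text \<open>The Burnside sum is reindexed by multipliers, of which there are
  \<open>totient n\<close>.\<close>

lemma (in odd_primes) Psi_w_eq_sum_units:
  "Polynomial.smult (of_nat (totient n)) (Psi_w (integer_mod_group n))
    = (\<Sum>u\<in>totatives n. \<Sum>I\<in>Pow K. (-1) ^ card I * (\<Prod>J\<in>{J. J \<subseteq> K - I \<and> J \<noteq> {}}. f_J p (index u) J))"
proof -
  interpret Z: group "integer_mod_group n" by simp
  let ?\<mu> = "\<lambda>u. \<lambda>x\<in>{0..<int n}. int u * x mod int n"
  have carr: "carrier (integer_mod_group n) = {0..<int n}"
    using n_gt_1 by (simp add: carrier_integer_mod_group)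
  have bij: "bij_betw ?\<mu> (totatives n) (auto (integer_mod_group n))"
    using n_gt_1 by (rule auto_integer_mod_group)
  then have "card (auto (integer_mod_group n)) = totient n"
    by (simp add: bij_betw_same_card totient_def)
  then have "Polynomial.smult (of_nat (totient n)) (Psi_w (integer_mod_group n))
      = (\<Sum>\<alpha>\<in>auto (integer_mod_group n). \<Sum>\<Omega> | \<Omega> \<in> cayley_sets (integer_mod_group n) \<and> \<alpha> ` \<Omega> = \<Omega>.
          Polynomial.monom 1 (card \<Omega>))"
    using Z.Psi_w_burnside n_gt_1 by (simp add: carr)
  also have "\<dots> = (\<Sum>u\<in>totatives n. \<Sum>\<Omega> | \<Omega> \<in> cayley_sets (integer_mod_group n) \<and> ?\<mu> u ` \<Omega> = \<Omega>.
          Polynomial.monom 1 (card \<Omega>))"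
    by (rule sum.reindex_bij_betw [OF bij, symmetric])
  also have "\<dots> = (\<Sum>u\<in>totatives n. \<Sum>I\<in>Pow K. (-1) ^ card I *
      (\<Prod>J\<in>{J. J \<subseteq> K - I \<and> J \<noteq> {}}. f_J p (index u) J))"
  proof (rule sum.cong [OF refl])
    fix u assume "u \<in> totatives n"
    then interpret odd_primes_unit K p n u
      by unfold_locales (simp add: totatives_def)
    show "(\<Sum>\<Omega> | \<Omega> \<in> cayley_sets (integer_mod_group n) \<and> ?\<mu> u ` \<Omega> = \<Omega>. Polynomial.monom 1 (card \<Omega>))
        = (\<Sum>I\<in>Pow K. (-1) ^ card I * (\<Prod>J\<in>{J. J \<subseteq> K - I \<and> J \<noteq> {}}. f_J p (index u) J))"
      by (rule sum_cayley_sets_invariant)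
  qed
  finally show ?thesis .
qed

text \<open>The fibre of \<open>index\<close> over \<open>d\<close> consists of the units of order
  \<open>(p i - 1) div d i\<close> modulo every \<open>p i\<close>, and
  \<open>card_units_with_orders\<close> counts it.\<close>

lemma (in odd_primes) sum_units_by_index:
  fixes G :: "(nat \<Rightarrow> nat) \<Rightarrow> rat poly"
  shows "(\<Sum>u\<in>totatives n. G (index u)) = (\<Sum>d \<in> (\<Pi>\<^sub>E i\<in>K. {e. e dvd p i - 1}).
      Polynomial.smult (of_nat (\<Prod>i\<in>K. totient ((p i - 1) div d i))) (G d))"
proof -
  let ?D = "\<Pi>\<^sub>E i\<in>K. {e. e dvd p i - 1}"
  have pos: "p i - 1 > 0" if "i \<in> K" for i using p_gt_2 [OF that] by simp
  have fin: "finite ?D" using finite_K pos by (intro finite_PiE) auto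
  have unit: "odd_primes_unit K p n u" if "u \<in> totatives n" for u
    using that by unfold_locales (simp add: totatives_def)
  have range: "index ` totatives n \<subseteq> ?D"
  proof (rule image_subsetI)
    fix u assume "u \<in> totatives n"
    then interpret odd_primes_unit K p n u by (rule unit)
    show "index u \<in> ?D" using index_dvd by (simp add: PiE_iff index_def)
  qed
  have "(\<Sum>u\<in>totatives n. G (index u)) = (\<Sum>d\<in>?D. \<Sum>u | u \<in> totatives n \<and> index u = d. G (index u))"
    by (rule sum.group [OF finite_totatives fin range, symmetric])
  also have "\<dots> = (\<Sum>d\<in>?D. Polynomial.smult (of_nat (\<Prod>i\<in>K. totient ((p i - 1) div d i))) (G d))"
  proof (rule sum.cong [OF refl])
    fix d assume d: "d \<in> ?D"
    have dvd: "d i dvd p i - 1" if "i \<in> K" for i using d that by (simp add: PiE_iff)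
    have "index u = d \<longleftrightarrow> (\<forall>i\<in>K. ord (p i) u = (p i - 1) div d i)" if "u \<in> totatives n" for u
    proof -
      interpret odd_primes_unit K p n u using that by (rule unit)
      show ?thesis
      proof
        assume "index u = d"
        then show "\<forall>i\<in>K. ord (p i) u = (p i - 1) div d i" using div_index by simp
      next
        assume *: "\<forall>i\<in>K. ord (p i) u = (p i - 1) div d i"
        have "index u i = d i" if i: "i \<in> K" for i
        proof -
          obtain q where q: "p i - 1 = d i * q" using dvd [OF i] by (rule dvdE)
          with pos [OF i] have qpos: "d i > 0" "q > 0" by (metis nat_0_less_mult_iff)+
          have "ord (p i) u = q" using bspec [OF * i] qpos unfolding q by simp
          moreover have "index u i = (p i - 1) div ord (p i) u" using i by (simp add: index_def)
          ultimately show ?thesis unfolding q using qpos by simp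
        qed
        \<comment> \<open>Off \<open>K\<close> both tuples are \<open>undefined\<close>, so
          agreement on \<open>K\<close> is equality of functions.\<close>
        moreover have "d i = undefined" if "i \<notin> K" for i using d that by (simp add: PiE_iff extensional_def)
        ultimately show "index u = d" by (auto simp: index_def fun_eq_iff)
      qed
    qed
    then have "{u \<in> totatives n. index u = d} = {u \<in> totatives n. \<forall>i\<in>K. ord (p i) u = (p i - 1) div d i}"
      by blast
    also have "card \<dots> = (\<Prod>i\<in>K. totient ((p i - 1) div d i))"
      by (rule card_units_with_orders) (metis dvd dvd_div_mult_self dvd_triv_left)
    finally have card: "card {u \<in> totatives n. index u = d} = (\<Prod>i\<in>K. totient ((p i - 1) div d i))" .
    have "(\<Sum>u | u \<in> totatives n \<and> index u = d. G (index u)) = (\<Sum>u | u \<in> totatives n \<and> index u = d. G d)"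
      by (rule sum.cong) auto
    also have "\<dots> = Polynomial.smult (of_nat (\<Prod>i\<in>K. totient ((p i - 1) div d i))) (G d)"
      by (simp only: sum_constant card) (simp add: of_nat_poly)
    finally show "(\<Sum>u | u \<in> totatives n \<and> index u = d. G (index u))
        = Polynomial.smult (of_nat (\<Prod>i\<in>K. totient ((p i - 1) div d i))) (G d)" .
  qed
  finally show ?thesis .
qed

theorem theorem4p6:
  fixes l n :: nat and p :: "nat \<Rightarrow> nat"
  assumes "l \<ge> 1"
    and "\<forall>i\<in>{1..l}. prime (p i) \<and> odd (p i)"
    and "inj_on p {1..l}"
    and "n = (\<Prod>i\<in>{1..l}. p i)"
  shows "Psi_w (integer_mod_group n) =
    Polynomial.smult (1 / (of_nat (totient n) :: rat))
      (\<Sum>d \<in> (\<Pi>\<^sub>E i\<in>{1..l}. {e. e dvd p i - 1}).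
         Polynomial.smult (of_nat (\<Prod>i\<in>{1..l}. totient ((p i - 1) div d i)))
           (\<Sum>I \<in> Pow {1..l}. (-1) ^ card I * F_I l p d I))"
proof -
  interpret odd_primes "{1..l}" p n
    using assms by unfold_locales auto
  have "totient n > 0" using n_gt_1 by simp
  then have "Psi_w (integer_mod_group n) = Polynomial.smult (1 / of_nat (totient n))
      (Polynomial.smult (of_nat (totient n)) (Psi_w (integer_mod_group n)))"
    by simp
  also have "Polynomial.smult (of_nat (totient n)) (Psi_w (integer_mod_group n))
      = (\<Sum>u\<in>totatives n. \<Sum>I\<in>Pow {1..l}. (-1) ^ card I * F_I l p (index u) I)"
    by (simp only: Psi_w_eq_sum_units F_I_def)
  \<comment> \<open>The inner sum depends on \<open>u\<close> only through
    \<open>index u\<close>.\<close>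
  also have "\<dots> = (\<Sum>d \<in> (\<Pi>\<^sub>E i\<in>{1..l}. {e. e dvd p i - 1}).
         Polynomial.smult (of_nat (\<Prod>i\<in>{1..l}. totient ((p i - 1) div d i)))
           (\<Sum>I \<in> Pow {1..l}. (-1) ^ card I * F_I l p d I))"
    by (rule sum_units_by_index)
  finally show ?thesis .
qed

end
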